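(* Let $q=p^m$ with $p$ prime such that $3\mid\frac{q-1}{p-1}$ and $q\ge5$, and put $n=\frac{q-1}{3}$. Then $\Gamma(3,q)$ is connected with integral spectrum given as follows. (a) If $p\equiv1\pmod3$, then $m=3t$ for some $t\in\mathbb N$ and $$\mathrm{Spec}(\Gamma(3,q))=\Big\{[n]^1,\Big[\tfrac{a\sqrt[3]q-1}{3}\Big]^n,\Big[\tfrac{-\frac12(a+9b)\sqrt[3]q-1}{3}\Big]^n,\Big[\tfrac{-\frac12(a-9b)\sqrt[3]q-1}{3}\Big]^n\Big\},$$ where $a,b$ are integers (with $a$ unique, $b$ unique up to sign) determined by $4\sqrt[3]q=a^2+27b^2$, $a\equiv1\pmod3$, $\gcd(a,p)=1$. (b) If $p\equiv2\pmod3$, then $m=2t$ for some $t\in\mathbb N$ and $$\mathrm{Spec}(\Gamma(3,q))=\begin{cases}\{[n]^1,[\frac{\sqrt q-1}{3}]^{2n},[\frac{-2\sqrt q-1}{3}]^n\} & m\equiv0\pmod4,\\ \{[n]^1,[\frac{2\sqrt q-1}{3}]^{n},[\frac{-\sqrt q-1}{3}]^{2n}\} & m\equiv2\pmod4;\end{cases}$$ in particular $\Gamma(3,q)$ is strongly regular in this case.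
   Context: Let $p$ be prime, $q=p^m$, $R_3=\{x^3:x\in\mathbb F_q^*\}$, and $\Gamma(3,q)$ the Cayley graph on $\mathbb F_q$ in which $u\to v$ is an edge iff $v-u\in R_3$. Spectrum = multiset of adjacency eigenvalues, written $\{[\lambda]^{\text{mult}}\}$. *)

theory Defs
  imports "HOL-Analysis.Analysis" "HOL-Computational_Algebra.Polynomial" "HOL-Library.Multiset"
begin

definition cubes :: "'a::field set" where
  "cubes = {x ^ 3 | x. x \<noteq> 0}"

definition cayley3 :: "'a::{field,finite} \<Rightarrow> 'a \<Rightarrow> bool" where
  "cayley3 u v \<longleftrightarrow> v - u \<in> cubes"

definition adj_matrix :: "('a::finite \<Rightarrow> 'a \<Rightarrow> bool) \<Rightarrow> real ^'a ^'a" where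
  "adj_matrix E = (\<chi> u v. if E u v then 1 else 0)"

definition charpoly :: "real ^'n ^'n \<Rightarrow> real poly" where
  "charpoly A = det (\<chi> i j. (if i = j then [:0, 1:] else 0) - [:A $ i $ j:])"

text \<open>M is the spectrum (multiset of eigenvalues, with algebraic multiplicity) of A:
  the characteristic polynomial factors as the product of (x - lambda) over M.\<close>
definition is_spectrum :: "real ^'n ^'n \<Rightarrow> real multiset \<Rightarrow> bool" where
  "is_spectrum A M \<longleftrightarrow> charpoly A = prod_mset (image_mset (\<lambda>l. [:-l, 1:]) M)"

definition graph_connected :: "('a \<Rightarrow> 'a \<Rightarrow> bool) \<Rightarrow> bool" where
  "graph_connected E \<longleftrightarrow> (\<forall>u v. E\<^sup>*\<^sup>* u v)"

definition strongly_regular :: "('a::finite \<Rightarrow> 'a \<Rightarrow> bool) \<Rightarrow> bool" where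
  "strongly_regular E \<longleftrightarrow>
     (\<forall>u v. E u v \<longleftrightarrow> E v u) \<and> (\<forall>u. \<not> E u u) \<and>
     (\<exists>k l m. (\<forall>u. card {w. E u w} = k) \<and>
        (\<forall>u v. E u v \<longrightarrow> card {w. E u w \<and> E v w} = l) \<and>
        (\<forall>u v. u \<noteq> v \<and> \<not> E u v \<longrightarrow> card {w. E u w \<and> E v w} = m))"

end

theory Submission
  imports Defs "HOL-Number_Theory.Residues"
begin

text \<open>
  The eigenvalues of the graph are the cubic periods \<open>\<eta>(b) = \<Sum>\<^bsub>x\<in>R\<^esub> \<psi>(b x)\<close>, with \<open>R\<close> the nonzero
  cubes and \<open>\<psi>\<close> a nontrivial additive character. The divisibility hypothesis says that the
  nonzero elements of the prime field are cubes, which makes every period an integer. For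
  \<open>b \<noteq> 0\<close> the numbers \<open>\<theta>(b) = 3 \<eta>(b) + 1\<close> take three values, each 1 modulo 3, and counting
  solutions of \<open>x\<^sup>3 + y\<^sup>3 = 0\<close> and \<open>x\<^sup>3 + y\<^sup>3 + z\<^sup>3 = 0\<close> shows that the elementary symmetric
  functions of these three are \<open>0\<close>, \<open>-3q\<close> and \<open>q c\<close> for an integer \<open>c\<close>.

  If \<open>p \<equiv> 2\<close> (mod 3), then \<open>p\<close> is inert for the form \<open>x\<^sup>2 + xy + y\<^sup>2\<close>, and the first two relations
  force the values \<open>\<plusminus>\<surd>q (1, 1, -2)\<close>. If \<open>p \<equiv> 1\<close> (mod 3), then \<open>c\<close> is congruent to minus the central
  binomial coefficient \<open>2n choose n\<close>, which is prime to \<open>p\<close>; a descent then removes exactly the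
  factor \<open>q\<^bsup>1/3\<^esup>\<close> from all three values, and the cofactors are read off from a representation
  \<open>4 q\<^bsup>1/3\<^esup> = a\<^sup>2 + 27 b\<^sup>2\<close>.
\<close>

section \<open>The forms \<open>x\<^sup>2 + xy + y\<^sup>2\<close> and \<open>x\<^sup>2 + 27y\<^sup>2\<close>\<close>

lemma cong_power_prime_int:
  fixes x :: int
  assumes "prime p"
  shows "[x ^ p = x] (mod int p)"
proof -
  define a where "a = nat (x mod int p)"
  have a: "[int a = x] (mod int p)"
    using assms prime_gt_0_nat[of p] by (simp add: a_def cong_def)
  have "[a ^ p = a] (mod p)"
  proof (cases "p dvd a")
    case True
    then have "p dvd a ^ p"
      using assms prime_gt_0_nat[of p] by (metis dvd_power dvd_trans)
    with True show ?thesis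
      by (simp add: cong_def)
  next
    case False
    have "[a * a ^ (p - 1) = a * 1] (mod p)"
      by (intro cong_mult cong_refl fermat_theorem assms False)
    then show ?thesis
      using assms prime_gt_0_nat[of p] by (simp add: power_eq_if)
  qed
  then have "[int a ^ p = int a] (mod int p)"
    by (metis cong_int_iff of_nat_power)
  then show ?thesis
    using a cong_pow[OF a, of p] by (metis cong_sym cong_trans)
qed

lemma cong_cube_imp_cong:
  fixes x y :: int
  assumes p: "prime p" "p mod 3 = 2" and cubes: "[x ^ 3 = y ^ 3] (mod int p)"
  shows "[x = y] (mod int p)"
proof -
  obtain j where j: "p = 3 * j + 2"
    using p(2) by (metis mult_div_mod_eq)
  define k where "k = 2 * j + 1"
  have exponent: "3 * k = p + (p - 1)"
    by (simp add: j k_def)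
  have cube_root: "[(z ^ 3) ^ k = z] (mod int p)" for z :: int
  proof -
    have "(z ^ 3) ^ k = z ^ p * z ^ (p - 1)"
      using exponent by (metis power_add power_mult)
    also have "[z ^ p * z ^ (p - 1) = z * z ^ (p - 1)] (mod int p)"
      using p(1) by (intro cong_mult cong_power_prime_int cong_refl)
    also have "z * z ^ (p - 1) = z ^ p"
      using p(1) prime_gt_0_nat[of p] by (simp add: power_eq_if)
    also have "[z ^ p = z] (mod int p)"
      using p(1) by (rule cong_power_prime_int)
    finally show ?thesis .
  qed
  show ?thesis
    by (rule cong_trans[OF cong_sym[OF cube_root] cong_trans[OF cong_pow[OF cubes] cube_root]])
qed

lemma prime_dvd_loeschian:
  fixes x y :: int
  assumes p: "prime p" "p mod 3 = 2" and dvd: "int p dvd x\<^sup>2 + x * y + y\<^sup>2"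
  shows "int p dvd x \<and> int p dvd y"
proof -
  have "x ^ 3 - y ^ 3 = (x - y) * (x\<^sup>2 + x * y + y\<^sup>2)"
    by (simp add: power2_eq_square power3_eq_cube algebra_simps)
  then have "[x ^ 3 = y ^ 3] (mod int p)"
    using dvd by (simp add: cong_iff_dvd_diff)
  then have xy: "int p dvd x - y"
    using cong_cube_imp_cong[OF p] by (simp add: cong_iff_dvd_diff)
  have "3 * x\<^sup>2 = (x\<^sup>2 + x * y + y\<^sup>2) + (x - y) * (2 * x + y)"
    by (simp add: power2_eq_square algebra_simps)
  then have "int p dvd 3 * x\<^sup>2"
    using dvd xy by (metis dvd_add dvd_mult2)
  moreover have "\<not> int p dvd 3"
  proof
    assume "int p dvd 3"
    then have "p dvd 3"
      by (metis int_dvd_int_iff of_nat_numeral)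
    then show False
      using p primes_dvd_imp_eq[of p 3] by auto
  qed
  ultimately have "int p dvd x"
    using p(1) by (auto simp: prime_dvd_mult_iff prime_dvd_power_iff)
  moreover from this have "int p dvd y"
    using xy by (metis dvd_diff diff_diff_eq2 add_diff_cancel_left')
  ultimately show ?thesis ..
qed

lemma loeschian_prime_power:
  fixes x y c :: int
  assumes p: "prime p" "p mod 3 = 2" and "x\<^sup>2 + x * y + y\<^sup>2 = c * int p ^ (2 * t)"
  obtains u v where "x = int p ^ t * u" "y = int p ^ t * v" "u\<^sup>2 + u * v + v\<^sup>2 = c"
proof -
  have "\<exists>u v. x = int p ^ t * u \<and> y = int p ^ t * v \<and> u\<^sup>2 + u * v + v\<^sup>2 = c"
    using assms(3)
  proof (induction t arbitrary: x y)
    case (Suc t)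
    then have "int p dvd x\<^sup>2 + x * y + y\<^sup>2"
      by simp
    then obtain x' y' where xy: "x = int p * x'" "y = int p * y'"
      using prime_dvd_loeschian[OF p] by (metis dvdE)
    have "(int p)\<^sup>2 * (x'\<^sup>2 + x' * y' + y'\<^sup>2) = (int p)\<^sup>2 * (c * int p ^ (2 * t))"
      using Suc.prems by (simp add: xy power2_eq_square algebra_simps)
    then have "x'\<^sup>2 + x' * y' + y'\<^sup>2 = c * int p ^ (2 * t)"
      using p(1) by (subst (asm) mult_left_cancel) auto
    from Suc.IH[OF this] show ?case
      by (auto simp: xy)
  qed auto
  then show ?thesis
    by (elim exE conjE) (rule that)
qed

lemma loeschian_eq_3:
  fixes x y :: int
  assumes "x\<^sup>2 + x * y + y\<^sup>2 = 3"
  shows "(x, y) \<in> {(1, 1), (1, - 2), (- 2, 1), (- 1, - 1), (- 1, 2), (2, - 1)}"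
proof -
  have bound: "v \<in> {- 2..2}" if "u\<^sup>2 + u * v + v\<^sup>2 = 3" for u v :: int
  proof -
    have "(2 * u + v)\<^sup>2 + 3 * v\<^sup>2 = 12"
      using that by (simp add: power2_eq_square algebra_simps)
    then have "3 * v\<^sup>2 \<le> 12"
      using zero_le_power2[of "2 * u + v"] by linarith
    then have "\<bar>v\<bar>\<^sup>2 < 3\<^sup>2"
      by simp
    then have "\<bar>v\<bar> < 3"
      by (rule power2_less_imp_less) simp
    then show ?thesis
      by auto
  qed
  have "y\<^sup>2 + y * x + x\<^sup>2 = 3"
    using assms by (simp add: algebra_simps)
  from bound[OF assms] bound[OF this]
  have "x \<in> {- 2, - 1, 0, 1, 2}" "y \<in> {- 2, - 1, 0, 1, 2}"
    by auto
  then show ?thesis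
    using assms by (elim insertE emptyE; simp)
qed

lemma prime_dvd_if_dvd_elementary_symmetric:
  fixes x y z p :: int
  assumes "prime p" "p dvd x + y + z" "p dvd x * y + y * z + z * x" "p dvd x * y * z"
  shows "p dvd x \<and> p dvd y \<and> p dvd z"
proof -
  have root: "p dvd u"
    if "p dvd u + v + w" "p dvd u * v + v * w + w * u" "p dvd u * v * w" for u v w
  proof -
    have "u ^ 3 = u\<^sup>2 * (u + v + w) - u * (u * v + v * w + w * u) + u * v * w"
      by (simp add: power2_eq_square power3_eq_cube algebra_simps)
    then have "p dvd u ^ 3"
      using that by (metis dvd_add dvd_diff dvd_mult)
    then show ?thesis
      using assms(1) prime_dvd_power by blast
  qed
  have rotate: "y + z + x = x + y + z" "z + x + y = x + y + z"
    "y * z + z * x + x * y = x * y + y * z + z * x" "z * x + x * y + y * z = x * y + y * z + z * x"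
    "y * z * x = x * y * z" "z * x * y = x * y * z"
    by simp_all
  show ?thesis
    using root[of x y z] root[of y z x] root[of z x y] assms(2-4) unfolding rotate by blast
qed

lemma triple_descent:
  fixes x y z c k p :: int
  assumes "prime p" "p dvd k" "x + y + z = 0"
    "x * y + y * z + z * x = k * p ^ (2 * j)" "x * y * z = c * p ^ (3 * j)"
  obtains u v w where "x = p ^ j * u" "y = p ^ j * v" "z = p ^ j * w"
    "u + v + w = 0" "u * v + v * w + w * u = k" "u * v * w = c"
proof -
  have "\<exists>u v w. x = p ^ j * u \<and> y = p ^ j * v \<and> z = p ^ j * w \<and>
      u + v + w = 0 \<and> u * v + v * w + w * u = k \<and> u * v * w = c"
    using assms(3-5)
  proof (induction j arbitrary: x y z)
    case (Suc j)
    have p_nonzero: "p \<noteq> 0"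
      using assms(1) by auto
    have "p dvd x \<and> p dvd y \<and> p dvd z"
      using Suc.prems assms(2)
      by (intro prime_dvd_if_dvd_elementary_symmetric[OF assms(1)]) simp_all
    then obtain x' y' z' where xyz: "x = p * x'" "y = p * y'" "z = p * z'"
      by (metis dvdE)
    have "p * (x' + y' + z') = p * 0"
      "p\<^sup>2 * (x' * y' + y' * z' + z' * x') = p\<^sup>2 * (k * p ^ (2 * j))"
      "p ^ 3 * (x' * y' * z') = p ^ 3 * (c * p ^ (3 * j))"
      using Suc.prems
      by (simp_all add: xyz power2_eq_square power3_eq_cube power_add algebra_simps)
    then have "x' + y' + z' = 0" "x' * y' + y' * z' + z' * x' = k * p ^ (2 * j)"
      "x' * y' * z' = c * p ^ (3 * j)"
      using p_nonzero by (simp_all only: mult_left_cancel power_not_zero not_False_eq_True)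
    from Suc.IH[OF this] obtain u v w where
      "x' = p ^ j * u" "y' = p ^ j * v" "z' = p ^ j * w"
      "u + v + w = 0" "u * v + v * w + w * u = k" "u * v * w = c"
      by blast
    then show ?case
      by (intro exI[of _ u] exI[of _ v] exI[of _ w]) (simp add: xyz)
  next
    case 0
    then show ?case
      by (intro exI[of _ x] exI[of _ y] exI[of _ z]) simp
  qed
  then show ?thesis
    by (elim exE conjE) (rule that)
qed

lemma inert_triple:
  fixes x y z :: int
  assumes p: "prime p" "p mod 3 = 2"
    and sum_eq: "x + y + z = 0" and products_eq: "x * y + y * z + z * x = - 3 * int p ^ (2 * t)"
    and mod3: "x mod 3 = 1" "y mod 3 = 1"
  shows "{#x, y, z#} = image_mset ((*) ((- int p) ^ t)) {#1, 1, - 2#}"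
proof -
  have z: "z = - x - y"
    using sum_eq by simp
  have "x\<^sup>2 + x * y + y\<^sup>2 = 3 * int p ^ (2 * t)"
    using products_eq by (simp add: z power2_eq_square algebra_simps)
  then obtain u v where uv: "x = int p ^ t * u" "y = int p ^ t * v" "u\<^sup>2 + u * v + v\<^sup>2 = 3"
    using loeschian_prime_power[OF p] by blast
  define u' v' where "u' = (- 1) ^ t * u" and "v' = (- 1) ^ t * v"
  have sign: "(- 1) ^ t * ((- 1) ^ t * k) = k" for k :: int
    by (simp flip: mult.assoc power_mult_distrib)
  have xy: "x = (- int p) ^ t * u'" "y = (- int p) ^ t * v'"
    using sign by (simp_all add: uv u'_def v'_def power_minus[of "int p"] mult_ac)
  have "[int p = - 1] (mod 3)"
    using p(2) unfolding cong_def by presburger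
  then have "[- int p = 1] (mod 3)"
    using cong_minus_minus_iff[of "int p" "- 1" 3] by simp
  then have "[(- int p) ^ t = 1 ^ t] (mod 3)"
    by (rule cong_pow)
  then have "[(- int p) ^ t * k = 1 * k] (mod 3)" for k
    by (intro cong_mult) simp_all
  then have "u' mod 3 = 1" "v' mod 3 = 1"
    using mod3 unfolding xy cong_def by simp_all
  moreover have "u'\<^sup>2 + u' * v' + v'\<^sup>2 = 3"
    using uv(3) sign by (simp add: u'_def v'_def power_mult_distrib mult_ac flip: power_mult)
  then have "(u', v') \<in> {(1, 1), (1, - 2), (- 2, 1), (- 1, - 1), (- 1, 2), (2, - 1)}"
    by (rule loeschian_eq_3)
  ultimately have "(u', v') \<in> {(1, 1), (1, - 2), (- 2, 1)}"
    by auto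
  then show ?thesis
    by (auto simp: z xy)
qed

lemma cong_9_of_triple:
  fixes x y z :: int
  assumes "x + y + z = 0" "x mod 3 = 1" "y mod 3 = 1"
  obtains u v w where "(u, v, w) \<in> {(x, y, z), (y, z, x), (z, x, y)}" "9 dvd w - v"
proof -
  obtain i j where xy: "x = 3 * i + 1" "y = 3 * j + 1"
    using assms(2,3) by (metis mult_div_mod_eq)
  then have z: "z = - 3 * i - 3 * j - 2"
    using assms(1) by simp
  have "3 dvd 2 * j + i + 1 \<or> 3 dvd 2 * i + j + 1 \<or> 3 dvd j - i"
    by presburger
  moreover have "z - y = - (3 * (2 * j + i + 1))" "x - z = 3 * (2 * i + j + 1)"
    "y - x = 3 * (j - i)"
    unfolding xy z by simp_all
  moreover have "9 dvd 3 * k" if "3 dvd k" for k :: int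
    using that by presburger
  ultimately consider "9 dvd z - y" | "9 dvd x - z" | "9 dvd y - x"
    by (metis dvd_minus_iff)
  then show thesis
    using that by cases blast+
qed

abbreviation split_values :: "int \<Rightarrow> int \<Rightarrow> real multiset" where
  "split_values a b \<equiv> {#of_int a, - (1/2) * of_int (a + 9 * b), - (1/2) * of_int (a - 9 * b)#}"

lemma norm_form_of_triple:
  fixes x y z P :: int
  assumes sum_eq: "x + y + z = 0" and products_eq: "x * y + y * z + z * x = - 3 * P"
    and dvd: "9 dvd z - y"
  obtains b where "4 * P = x\<^sup>2 + 27 * b\<^sup>2"
    "image_mset real_of_int {#x, y, z#} = split_values x b"
proof -
  obtain b where "z - y = 9 * b"
    using dvd by (elim dvdE)
  then have z: "z = y + 9 * b"
    by simp
  then have x: "x = - 2 * y - 9 * b"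
    using sum_eq by simp
  have "3 * (4 * P) = 3 * (x\<^sup>2 + 27 * b\<^sup>2)"
    using products_eq unfolding x z power2_eq_square by (simp add: algebra_simps)
  moreover have "image_mset real_of_int {#x, y, z#} = split_values x b"
    unfolding x z by (simp add: field_simps)
  ultimately show ?thesis
    using that[of b] by simp
qed

text \<open>Exactly two of the three integers agree modulo 9; \<open>a\<close> is the third one, and \<open>9b\<close> is the
  difference of those two.\<close>

lemma split_triple:
  fixes x y z P :: int
  assumes sum_eq: "x + y + z = 0" and products_eq: "x * y + y * z + z * x = - 3 * P"
    and mod3: "x mod 3 = 1" "y mod 3 = 1"
  obtains a b where "a \<in> {x, y, z}" "4 * P = a\<^sup>2 + 27 * b\<^sup>2"
    "image_mset real_of_int {#x, y, z#} = split_values a b"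
proof -
  obtain u v w where uvw: "(u, v, w) \<in> {(x, y, z), (y, z, x), (z, x, y)}" and dvd: "9 dvd w - v"
    using cong_9_of_triple[OF sum_eq mod3] .
  have "u + v + w = 0" "u * v + v * w + w * u = - 3 * P"
    using uvw sum_eq products_eq by auto
  then obtain b where "4 * P = u\<^sup>2 + 27 * b\<^sup>2" "image_mset real_of_int {#u, v, w#} = split_values u b"
    using norm_form_of_triple[OF _ _ dvd] by metis
  moreover have "u \<in> {x, y, z}" "{#x, y, z#} = {#u, v, w#}"
    using uvw by auto
  ultimately show thesis
    using that by metis
qed

definition normalized_rep :: "int \<Rightarrow> int \<Rightarrow> int \<Rightarrow> int \<Rightarrow> bool" where
  "normalized_rep p P a b \<longleftrightarrow> 4 * P = a\<^sup>2 + 27 * b\<^sup>2 \<and> a mod 3 = 1 \<and> coprime a p"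

lemma cross_eq_if_dvd:
  fixes a b a' b' P :: int
  assumes P: "P > 0" and eq: "4 * P = a\<^sup>2 + 27 * b\<^sup>2" "4 * P = a'\<^sup>2 + 27 * b'\<^sup>2"
    and dvd: "2 * P dvd a * b' - a' * b"
  shows "a * b' = a' * b"
proof -
  obtain k where k: "a * b' - a' * b = 2 * P * k"
    using dvd by (elim dvdE)
  have "16 * P\<^sup>2 = (4 * P) * (4 * P)"
    by (simp add: power2_eq_square)
  also have "\<dots> = (a\<^sup>2 + 27 * b\<^sup>2) * (a'\<^sup>2 + 27 * b'\<^sup>2)"
    using eq by simp
  also have "\<dots> = (a * a' + 27 * b * b')\<^sup>2 + 27 * (a * b' - a' * b)\<^sup>2"
    by (simp add: power2_eq_square algebra_simps)
  also have "\<dots> = (a * a' + 27 * b * b')\<^sup>2 + P\<^sup>2 * (108 * k\<^sup>2)"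
    unfolding k by (simp add: power2_eq_square algebra_simps)
  finally have "P\<^sup>2 * (108 * k\<^sup>2) \<le> P\<^sup>2 * 16"
    using zero_le_power2[of "a * a' + 27 * b * b'"] by linarith
  then have "108 * k\<^sup>2 \<le> 16"
    using P by (simp add: mult_le_cancel_left)
  then have "k\<^sup>2 < 1"
    by linarith
  then show ?thesis
    using k by (simp add: abs_square_less_1)
qed

lemma normalized_rep_unique_if_dvd:
  assumes P: "P > 0" "odd P" and rep: "normalized_rep p P a b" "normalized_rep p P a' b'"
    and dvd: "P dvd a * b' - a' * b"
  shows "a = a' \<and> \<bar>b\<bar> = \<bar>b'\<bar>"
proof -
  have eq: "4 * P = a\<^sup>2 + 27 * b\<^sup>2" "4 * P = a'\<^sup>2 + 27 * b'\<^sup>2"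
    and mod3: "a mod 3 = 1" "a' mod 3 = 1"
    using rep by (simp_all add: normalized_rep_def)
  have "even (a\<^sup>2 + 27 * b\<^sup>2)" "even (a'\<^sup>2 + 27 * b'\<^sup>2)"
    unfolding eq[symmetric] by simp_all
  then have "2 dvd a * b' - a' * b"
    by auto
  moreover have "coprime 2 P"
    using P(2) by simp
  ultimately have "2 * P dvd a * b' - a' * b"
    using dvd divides_mult by blast
  then have cross: "a * b' = a' * b"
    by (rule cross_eq_if_dvd[OF P(1) eq])
  have "a\<^sup>2 * (4 * P) = a\<^sup>2 * a'\<^sup>2 + 27 * (a * b')\<^sup>2"
    unfolding eq(2) by (simp add: power2_eq_square algebra_simps)
  also have "\<dots> = a'\<^sup>2 * (4 * P)"
    unfolding cross eq(1) by (simp add: power2_eq_square algebra_simps)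
  finally have "a = a' \<or> a = - a'"
    using P(1) by (simp add: power2_eq_iff)
  then have "a = a'"
    using mod3 by presburger
  then show ?thesis
    using eq by (auto simp: power2_eq_iff)
qed

lemma not_dvd_if_normalized_rep:
  assumes p: "prime p" and t: "t > 0" and rep: "normalized_rep p (p ^ t) a b"
  shows "\<not> p dvd a" "\<not> p dvd b"
proof -
  have eq: "4 * p ^ t = a\<^sup>2 + 27 * b\<^sup>2" and "coprime a p"
    using rep by (simp_all add: normalized_rep_def)
  then show a: "\<not> p dvd a"
    using p by (metis coprime_common_divisor dvd_refl not_prime_unit)
  show "\<not> p dvd b"
  proof
    assume "p dvd b"
    then have "p dvd 4 * p ^ t - 27 * b\<^sup>2"
      using t by (intro dvd_diff) (auto simp: power2_eq_square)
    then have "p dvd a\<^sup>2"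
      using eq by simp
    then show False
      using a p prime_dvd_power by blast
  qed
qed

lemma normalized_rep_prime_power_dvd_cross:
  assumes p: "prime p" "odd p" and t: "t > 0"
    and rep: "normalized_rep p (p ^ t) a b" "normalized_rep p (p ^ t) a' b'"
  shows "p ^ t dvd a * b' - a' * b \<or> p ^ t dvd a * b' + a' * b"
proof -
  let ?P = "p ^ t"
  have eq: "4 * ?P = a\<^sup>2 + 27 * b\<^sup>2" "4 * ?P = a'\<^sup>2 + 27 * b'\<^sup>2"
    using rep by (simp_all add: normalized_rep_def)
  have "(a * b' - a' * b) * (a * b' + a' * b) =
      (a\<^sup>2 + 27 * b\<^sup>2) * b'\<^sup>2 - (a'\<^sup>2 + 27 * b'\<^sup>2) * b\<^sup>2"
    by (simp add: power2_eq_square algebra_simps)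
  then have "?P dvd (a * b' - a' * b) * (a * b' + a' * b)"
    unfolding eq[symmetric] by simp
  moreover have "\<not> (p dvd a * b' - a' * b \<and> p dvd a * b' + a' * b)"
  proof
    assume "p dvd a * b' - a' * b \<and> p dvd a * b' + a' * b"
    then have "p dvd (a * b' - a' * b) + (a * b' + a' * b)"
      using dvd_add by blast
    then have "p dvd 2 * (a * b')"
      by simp
    then have "p dvd 2"
      using p(1) not_dvd_if_normalized_rep[OF p(1) t] rep by (auto simp: prime_dvd_mult_iff)
    then show False
      using p primes_dvd_imp_eq[of p 2] by auto
  qed
  ultimately show ?thesis
    using p(1) prime_imp_power_coprime coprime_dvd_mult_left_iff coprime_dvd_mult_right_iff
      coprime_commute by metis
qed

lemma normalized_rep_unique:
  assumes p: "prime p" "odd p" and t: "t > 0"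
    and rep: "normalized_rep p (p ^ t) a b" "normalized_rep p (p ^ t) a' b'"
  shows "a = a' \<and> \<bar>b\<bar> = \<bar>b'\<bar>"
proof -
  have P: "p ^ t > 0" "odd (p ^ t)"
    using p by (simp_all add: prime_gt_0_int)
  consider "p ^ t dvd a * b' - a' * b" | "p ^ t dvd a * b' + a' * b"
    using normalized_rep_prime_power_dvd_cross[OF p t rep] by blast
  then show ?thesis
  proof cases
    case 1
    then show ?thesis
      by (rule normalized_rep_unique_if_dvd[OF P rep])
  next
    case 2
    have "normalized_rep p (p ^ t) a (- b)"
      using rep(1) by (simp add: normalized_rep_def)
    then have "a = a' \<and> \<bar>- b\<bar> = \<bar>b'\<bar>"
      using rep(2) by (rule normalized_rep_unique_if_dvd[OF P]) (use 2 in simp)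
    then show ?thesis
      by simp
  qed
qed

section \<open>Binomial coefficients modulo a prime\<close>

lemma fact_prime_part:
  fixes n :: nat
  assumes p: "prime p"
  shows "\<exists>u. fact n = p ^ (n div p) * fact (n div p) * u \<and> \<not> p dvd u"
proof (induction n)
  case 0
  then show ?case
    using p by (intro exI[of _ 1]) auto
next
  case (Suc n)
  then obtain u where u: "fact n = p ^ (n div p) * fact (n div p) * u" "\<not> p dvd u"
    by blast
  show ?case
  proof (cases "p dvd Suc n")
    case True
    then have div: "Suc n div p = Suc (n div p)"
      by (simp add: div_Suc dvd_eq_mod_eq_0)
    then have "Suc n = p * Suc (n div p)"
      using True by (metis dvd_mult_div_cancel)
    then have "fact (Suc n) = p * Suc (n div p) * (p ^ (n div p) * fact (n div p) * u)"
      unfolding fact_Suc u(1) by (metis of_nat_id)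
    also have "\<dots> = p ^ Suc (n div p) * fact (Suc (n div p)) * u"
      unfolding fact_Suc power_Suc of_nat_id by (simp only: mult_ac)
    finally show ?thesis
      using u(2) div by auto
  next
    case False
    then have "Suc n div p = n div p"
      by (simp add: div_Suc dvd_eq_mod_eq_0)
    moreover have "\<not> p dvd Suc n * u"
      using False u(2) p by (simp add: prime_dvd_mult_iff del: mult_Suc)
    moreover have "fact (Suc n) = p ^ (n div p) * fact (n div p) * (Suc n * u)"
      unfolding fact_Suc u(1) of_nat_id by (simp only: mult_ac)
    ultimately show ?thesis
      by (intro exI[of _ "Suc n * u"]) simp
  qed
qed

lemma prime_dvd_binomial_iff:
  assumes p: "prime p" and "b < p" "d \<le> b" "c \<le> a"
  shows "p dvd (p * a + b choose (p * c + d)) \<longleftrightarrow> p dvd (a choose c)"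
proof -
  let ?N = "p * a + b" and ?K = "p * c + d"
  have K: "?K \<le> ?N"
    using assms by (intro add_mono mult_le_mono) simp_all
  have diff: "?N - ?K = p * (a - c) + (b - d)"
    using assms by (simp add: right_diff_distrib' mult_le_mono2)
  have quotient: "(p * i + j) div p = i" if "j < p" for i j
    using that by (simp add: div_mult_self4)
  have div: "?N div p = a" "?K div p = c" "(?N - ?K) div p = a - c"
    unfolding diff by (rule quotient, use assms(2,3) in simp)+
  obtain u where u: "fact ?N = p ^ a * fact a * u" "\<not> p dvd u"
    using fact_prime_part[OF p, of ?N] unfolding div by blast
  obtain v where v: "fact ?K = p ^ c * fact c * v" "\<not> p dvd v"
    using fact_prime_part[OF p, of ?K] unfolding div by blast
  obtain w where w: "fact (?N - ?K) = p ^ (a - c) * fact (a - c) * w" "\<not> p dvd w"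
    using fact_prime_part[OF p, of "?N - ?K"] unfolding div by blast
  let ?C = "p ^ a * (fact c * fact (a - c))"
  have "?C * ((?N choose ?K) * (v * w)) =
      p ^ c * p ^ (a - c) * (fact c * fact (a - c)) * ((?N choose ?K) * (v * w))"
    using assms(4) by (simp flip: power_add)
  also have "\<dots> = fact ?K * fact (?N - ?K) * (?N choose ?K)"
    unfolding v(1) w(1) by (simp only: mult_ac)
  also have "\<dots> = fact ?N"
    by (rule binomial_fact_lemma[OF K])
  also have "\<dots> = ?C * ((a choose c) * u)"
    unfolding u(1) binomial_fact_lemma[OF assms(4), symmetric] by (simp only: mult_ac)
  finally have "(?N choose ?K) * (v * w) = (a choose c) * u"
    using p by (subst (asm) mult_left_cancel) auto
  then have "p dvd (?N choose ?K) * (v * w) \<longleftrightarrow> p dvd (a choose c) * u"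
    by simp
  then show ?thesis
    using p u(2) v(2) w(2) by (simp add: prime_dvd_mult_iff)
qed

lemma not_prime_dvd_central_binomial:
  assumes p: "prime p" "p mod d = 1" and d: "d \<ge> 2"
  shows "\<not> p dvd (2 * ((p ^ m - 1) div d) choose ((p ^ m - 1) div d))"
proof (induction m)
  case 0
  then show ?case
    using p(1) by auto
next
  case (Suc m)
  define k where "k = p div d"
  have p_eq: "p = d * k + 1"
    using p(2) by (metis k_def mult_div_mod_eq)
  have "p ^ m mod d = 1"
    using p(2) d power_mod[of p d m] by simp
  then obtain N where N: "p ^ m = d * N + 1"
    by (metis mult_div_mod_eq)
  have "p ^ Suc m = d * (p * N) + p"
    by (simp add: N algebra_simps)
  also have "\<dots> = d * (p * N) + (d * k + 1)"
    using p_eq by linarith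
  finally have "p ^ Suc m = d * (p * N + k) + 1"
    by (simp add: distrib_left)
  then have n: "(p ^ Suc m - 1) div d = p * N + k" "(p ^ m - 1) div d = N"
    using d N by simp_all
  have "2 * k \<le> d * k"
    using d by simp
  then have "2 * k < p"
    using p_eq by linarith
  then have "p dvd (p * (2 * N) + 2 * k choose (p * N + k)) \<longleftrightarrow> p dvd (2 * N choose N)"
    by (intro prime_dvd_binomial_iff p) simp_all
  then show ?case
    using Suc unfolding n by (simp add: algebra_simps)
qed

section \<open>Characteristic polynomials and eigenbases\<close>

definition const_poly_matrix :: "'a::zero ^'n ^'m \<Rightarrow> 'a poly ^'n ^'m" where
  "const_poly_matrix A = (\<chi> i j. [:A $ i $ j:])"

lemma const_poly_matrix_mult:
  fixes A :: "'a::comm_semiring_1 ^'n ^'m" and B :: "'a ^'k ^'n"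
  shows "const_poly_matrix (A ** B) = const_poly_matrix A ** const_poly_matrix B"
proof -
  have "[:\<Sum>k\<in>UNIV. f k:] = (\<Sum>k\<in>UNIV. [:f k:])" for f :: "'n \<Rightarrow> 'a"
    by (simp add: monom_sum flip: monom_0)
  then show ?thesis
    by (simp add: const_poly_matrix_def matrix_matrix_mult_def vec_eq_iff mult.commute)
qed

lemma mat_mult_commute:
  fixes A :: "'a::comm_semiring_1 ^'n ^'n"
  shows "mat c ** A = A ** mat c"
proof -
  have "(mat c ** A) $ i $ j = c * A $ i $ j" "(A ** mat c) $ i $ j = A $ i $ j * c" for i j
    by (simp_all add: matrix_matrix_mult_def mat_def if_distrib[of "\<lambda>x. x * _"]
        if_distrib[of "(*) _"]
        cong: if_cong)
  then show ?thesis
    by (simp add: vec_eq_iff mult.commute)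
qed

lemma charpoly_eq_det: "charpoly A = det (mat [:0, 1:] - const_poly_matrix A)"
  unfolding charpoly_def
  by (rule arg_cong[of _ _ det]) (simp add: vec_eq_iff mat_def const_poly_matrix_def)

lemma charpoly_similar:
  fixes A D P :: "real ^'n ^'n"
  assumes "invertible P" and similar: "A ** P = P ** D"
  shows "charpoly A = charpoly D"
proof -
  let ?C = const_poly_matrix
  obtain Q where "P ** Q = mat 1"
    using assms(1) by (auto simp: invertible_def)
  moreover have "?C (mat 1 :: real ^'n ^'n) = mat 1"
    by (simp add: const_poly_matrix_def mat_def vec_eq_iff one_pCons)
  ultimately have "det (?C P) * det (?C Q) = 1"
    by (metis const_poly_matrix_mult det_I det_mul)
  then have "det (?C P) \<noteq> 0"
    by auto
  moreover have "(X - Y) ** Z = X ** Z - Y ** Z" "Z ** (X - Y) = Z ** X - Z ** Y"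
    for X Y Z :: "real poly ^'n ^'n"
    by (simp_all add: vec_eq_iff matrix_matrix_mult_def left_diff_distrib right_diff_distrib
        sum_subtractf)
  then have "(mat [:0, 1:] - ?C A) ** ?C P = ?C P ** (mat [:0, 1:] - ?C D)"
    by (simp add: mat_mult_commute similar flip: const_poly_matrix_mult)
  then have "charpoly A * det (?C P) = det (?C P) * charpoly D"
    unfolding charpoly_eq_det by (metis det_mul)
  ultimately show ?thesis
    by simp
qed

lemma charpoly_diagonal:
  fixes l :: "'n::finite \<Rightarrow> real"
  shows "charpoly (\<chi> i j. if i = j then l i else 0) = (\<Prod>i\<in>UNIV. [:- l i, 1:])"
  unfolding charpoly_def by (subst det_diagonal) simp_all

lemma is_spectrum_if_orthogonal_eigenbasis:
  fixes A :: "real ^'n ^'n" and H :: "'n \<Rightarrow> 'n \<Rightarrow> real"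
  assumes eigen: "\<And>u b. (\<Sum>v\<in>UNIV. A $ u $ v * H v b) = l b * H u b"
    and orth: "\<And>u v. (\<Sum>b\<in>UNIV. H u b * H v b) = (if u = v then c else 0)" and c: "c \<noteq> 0"
  shows "is_spectrum A (image_mset l (mset_set UNIV))"
proof -
  define P :: "real ^'n ^'n" where "P = (\<chi> u b. H u b)"
  let ?D = "\<chi> i j. if i = j then l i else 0"
  have "P ** transpose P = c *\<^sub>R mat 1"
    by (simp add: vec_eq_iff P_def matrix_matrix_mult_def transpose_def mat_def orth)
  then have "P ** ((1 / c) *\<^sub>R transpose P) = mat 1"
    using c by (simp add: matrix_scalar_ac flip: scalar_matrix_assoc)
  then have "invertible P"
    by (auto simp: invertible_right_inverse)
  moreover have "(A ** P) $ u $ b = l b * H u b" "(P ** ?D) $ u $ b = l b * H u b" for u b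
    by (simp_all add: matrix_matrix_mult_def P_def eigen if_distrib[of "(*) _"] cong: if_cong)
  then have "A ** P = P ** ?D"
    by (simp add: vec_eq_iff)
  ultimately have "charpoly A = charpoly ?D"
    by (rule charpoly_similar)
  then show ?thesis
    by (simp add: is_spectrum_def charpoly_diagonal prod_unfold_prod_mset
        image_mset.compositionality comp_def)
qed

section \<open>Power sums and the trace in finite fields\<close>

lemma prime_CHAR_finite_field: "prime CHAR('a::{field,finite})"
  using prime_CHAR_semidom[where ?'a = 'a] finite_imp_CHAR_pos[where ?'a = 'a] by simp

lemma of_nat_CARD_finite_field: "of_nat CARD('a) = (0::'a::{field,finite})"
  using CHAR_dvd_CARD[where ?'a = 'a] of_nat_eq_0_iff_char_dvd by blast

lemma CHAR_eq_if_CARD_prime_power: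
  assumes "prime p" "CARD('a::{field,finite}) = p ^ m"
  shows "CHAR('a) = p"
proof -
  have "CHAR('a) dvd p ^ m"
    using CHAR_dvd_CARD[where ?'a = 'a] assms(2) by simp
  then show ?thesis
    using assms(1) prime_CHAR_finite_field prime_dvd_power primes_dvd_imp_eq by blast
qed

text \<open>The library states the next fact for the class \<open>finite_field\<close>, which the sort
  \<open>{field, finite}\<close> does not imply.\<close>

lemma power_CARD_minus_1:
  fixes x :: "'a::{field,finite}"
  assumes "x \<noteq> 0"
  shows "x ^ (CARD('a) - 1) = 1"
proof -
  let ?U = "UNIV - {0::'a}"
  have "\<Prod>?U = (\<Prod>y\<in>?U. x * y)"
    by (rule prod.reindex_bij_witness[of _ "\<lambda>y. x * y" "\<lambda>y. y / x"]) (use assms in auto)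
  also have "\<dots> = x ^ (CARD('a) - 1) * \<Prod>?U"
    by (simp add: prod.distrib)
  finally show ?thesis
    by simp
qed

lemma power_CARD:
  fixes x :: "'a::{field,finite}"
  shows "x ^ CARD('a) = x"
  using power_CARD_minus_1[of x] by (cases "x = 0") (simp_all add: power_eq_if)

lemma card_roots_of_unity_le:
  assumes "k > 0"
  shows "card {x::'a::idom. x ^ k = 1} \<le> k"
proof -
  let ?P = "Polynomial.monom (1::'a) k - 1"
  have "Polynomial.coeff ?P k = 1"
    using assms by simp
  then have "?P \<noteq> 0"
    by (metis coeff_0 zero_neq_one)
  then have "card {x. poly ?P x = 0} \<le> Polynomial.degree ?P"
    by (rule card_poly_roots_bound)
  also have "Polynomial.degree ?P \<le> k"
    by (intro degree_diff_le) (auto simp: degree_monom_le)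
  finally show ?thesis
    by (simp add: poly_monom)
qed

lemma ex_nonzero_power_neq_1:
  assumes "0 < k" "k < CARD('a::{field,finite}) - 1"
  shows "\<exists>y::'a. y \<noteq> 0 \<and> y ^ k \<noteq> 1"
proof (rule ccontr)
  assume "\<not> ?thesis"
  then have "UNIV - {0} \<subseteq> {y::'a. y ^ k = 1}"
    by auto
  then have "card (UNIV - {0::'a}) \<le> card {y::'a. y ^ k = 1}"
    by (intro card_mono) auto
  also have "\<dots> \<le> k"
    using assms(1) by (rule card_roots_of_unity_le)
  finally show False
    using assms(2) by simp
qed

lemma sum_powers_finite_field:
  assumes "k > 0"
  shows "(\<Sum>x\<in>UNIV. x ^ k) = (if CARD('a) - 1 dvd k then - 1 else (0::'a::{field,finite}))"
proof (cases "CARD('a) - 1 dvd k")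
  case True
  then have "x ^ k = (if x = 0 then 0 else 1)" for x :: 'a
    using power_CARD_minus_1[of x] assms by (auto simp: power_mult zero_power)
  then have "(\<Sum>x\<in>UNIV. x ^ k) = (\<Sum>x\<in>UNIV - {0::'a}. 1::'a)"
    by (intro sum.mono_neutral_cong_right) auto
  also have "\<dots> = of_nat CARD('a) - 1"
    using finite_UNIV_card_ge_0[where ?'a = 'a] by (simp add: of_nat_diff Suc_leI)
  finally show ?thesis
    using True by (simp add: of_nat_CARD_finite_field)
next
  case False
  define r where "r = k mod (CARD('a) - 1)"
  have "card {0, 1::'a} \<le> CARD('a)"
    by (intro card_mono) auto
  then have "0 < r" "r < CARD('a) - 1"
    using False by (auto simp: r_def dvd_eq_mod_eq_0)
  then obtain y :: 'a where y: "y \<noteq> 0" "y ^ r \<noteq> 1"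
    using ex_nonzero_power_neq_1 by blast
  have "y ^ k = y ^ ((CARD('a) - 1) * (k div (CARD('a) - 1)) + r)"
    by (simp add: r_def)
  also have "\<dots> = y ^ r"
    using power_CARD_minus_1[OF y(1)] by (simp add: power_add power_mult)
  finally have y_power: "y ^ k \<noteq> 1"
    using y(2) by simp
  have "(\<Sum>x\<in>UNIV. x ^ k) = (\<Sum>x\<in>UNIV. (y * x) ^ k)"
    by (rule sum.reindex_bij_witness[of _ "\<lambda>x. y * x" "\<lambda>x. x / y"]) (use y in auto)
  also have "\<dots> = y ^ k * (\<Sum>x\<in>UNIV. x ^ k)"
    by (simp add: power_mult_distrib sum_distrib_left)
  finally have "(1 - y ^ k) * (\<Sum>x\<in>UNIV. x ^ k) = 0"
    by (simp add: algebra_simps)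
  then show ?thesis
    using y_power False by simp
qed

lemma sum_one_minus_power_power:
  assumes d: "d > 0"
  shows "(\<Sum>x\<in>UNIV. (1 - x ^ d) ^ N) =
    - (\<Sum>j | 0 < j \<and> j \<le> N \<and> CARD('a) - 1 dvd d * j.
        of_nat (N choose j) * (- 1) ^ j :: 'a::{field,finite})"
proof -
  have powers: "(\<Sum>x\<in>UNIV. x ^ (d * j)) = (if 0 < j \<and> CARD('a) - 1 dvd d * j then - 1 else (0::'a))"
    for j
  proof (cases "j = 0")
    case True
    then show ?thesis
      by (simp add: of_nat_CARD_finite_field)
  next
    case False
    then show ?thesis
      using sum_powers_finite_field[where ?'a = 'a, of "d * j"] d by simp
  qed
  have binomial: "(1 - x ^ d) ^ N = (\<Sum>j\<le>N. of_nat (N choose j) * (- 1) ^ j * x ^ (d * j))"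
    for x :: 'a
  proof -
    have "(1 - x ^ d) ^ N = (\<Sum>j\<le>N. of_nat (N choose j) * (- (x ^ d)) ^ j)"
      using binomial_ring[of "- (x ^ d)" 1 N] by simp
    also have "\<dots> = (\<Sum>j\<le>N. of_nat (N choose j) * (- 1) ^ j * x ^ (d * j))"
      by (intro sum.cong refl) (simp add: power_minus[of "x ^ d"] power_mult mult.assoc)
    finally show ?thesis .
  qed
  have "(\<Sum>x\<in>UNIV. (1 - x ^ d) ^ N :: 'a) =
      (\<Sum>j\<le>N. \<Sum>x\<in>UNIV. of_nat (N choose j) * (- 1) ^ j * x ^ (d * j))"
    unfolding binomial by (rule sum.swap)
  also have "\<dots> =
      (\<Sum>j\<le>N. of_nat (N choose j) * (- 1) ^ j * (if 0 < j \<and> CARD('a) - 1 dvd d * j then - 1 else 0))"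
    by (simp only: powers flip: sum_distrib_left)
  also have "\<dots> = (\<Sum>j | 0 < j \<and> j \<le> N \<and> CARD('a) - 1 dvd d * j. - (of_nat (N choose j) * (- 1) ^ j))"
    by (intro sum.mono_neutral_cong_right) auto
  finally show ?thesis
    by (simp add: sum_negf)
qed

lemma of_nat_power_CHAR:
  assumes "prime CHAR('a::comm_semiring_1)"
  shows "(of_nat k :: 'a) ^ CHAR('a) = of_nat k"
  using freshmans_dream_sum[OF assms refl, of "\<lambda>_. 1" "{..<k}"] by simp

lemma prime_field_eq:
  assumes "prime CHAR('a::field)"
  shows "{y::'a. y ^ CHAR('a) = y} = of_nat ` {..<CHAR('a)}"
proof (rule sym, rule card_seteq)
  let ?P = "Polynomial.monom (1::'a) CHAR('a) - Polynomial.monom 1 1"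
  have CHAR: "CHAR('a) > 1"
    using assms prime_gt_1_nat by blast
  then have "Polynomial.coeff ?P CHAR('a) = 1"
    by simp
  then have P: "?P \<noteq> 0"
    by (metis coeff_0 zero_neq_one)
  have roots: "{y::'a. y ^ CHAR('a) = y} = {y. poly ?P y = 0}"
    by (simp add: poly_monom)
  show "finite {y::'a. y ^ CHAR('a) = y}"
    unfolding roots using P by (rule poly_roots_finite)
  have "card {y. poly ?P y = 0} \<le> Polynomial.degree ?P"
    using P by (rule card_poly_roots_bound)
  also have "\<dots> \<le> CHAR('a)"
    using CHAR by (intro degree_diff_le) (auto intro: order.trans[OF degree_monom_le])
  also have "\<dots> = card (of_nat ` {..<CHAR('a)} :: 'a set)"
    by (subst card_image) (auto intro!: inj_onI simp: of_nat_eq_iff_cong_CHAR cong_def)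
  finally show "card {y::'a. y ^ CHAR('a) = y} \<le> card (of_nat ` {..<CHAR('a)} :: 'a set)"
    unfolding roots .
  show "of_nat ` {..<CHAR('a)} \<subseteq> {y::'a. y ^ CHAR('a) = y}"
    using of_nat_power_CHAR[OF assms] by auto
qed

definition frobenius_trace :: "nat \<Rightarrow> 'a::comm_semiring_1 \<Rightarrow> 'a" where
  "frobenius_trace m x = (\<Sum>i<m. x ^ (CHAR('a) ^ i))"

lemma frobenius_trace_add:
  fixes x y :: "'a::comm_semiring_1"
  assumes "prime CHAR('a)"
  shows "frobenius_trace m (x + y) = frobenius_trace m x + frobenius_trace m y"
  using freshmans_dream'[OF assms refl, of x y] by (simp add: frobenius_trace_def sum.distrib)

lemma frobenius_trace_power_CHAR:
  fixes x :: "'a::{field,finite}"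
  assumes card: "CARD('a) = CHAR('a) ^ m"
  shows "frobenius_trace m x ^ CHAR('a) = frobenius_trace m x"
proof -
  have "frobenius_trace m x ^ CHAR('a) = (\<Sum>i<m. x ^ (CHAR('a) ^ Suc i))"
    using freshmans_dream_sum[OF prime_CHAR_finite_field refl, of "\<lambda>i. x ^ (CHAR('a) ^ i)" "{..<m}"]
    by (simp add: frobenius_trace_def mult.commute flip: power_mult)
  moreover have "(\<Sum>i<Suc m. x ^ (CHAR('a) ^ i)) = x + (\<Sum>i<m. x ^ (CHAR('a) ^ Suc i))"
    by (subst sum.lessThan_Suc_shift) simp
  moreover have "(\<Sum>i<Suc m. x ^ (CHAR('a) ^ i)) = frobenius_trace m x + x"
    using power_CARD[of x] card by (simp add: frobenius_trace_def)
  ultimately show ?thesis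
    by simp
qed

lemma ex_frobenius_trace_neq_0:
  assumes card: "CARD('a::{field,finite}) = CHAR('a) ^ m"
  shows "\<exists>x::'a. frobenius_trace m x \<noteq> 0"
proof (rule ccontr)
  assume "\<not> ?thesis"
  then have trace: "frobenius_trace m x = 0" for x :: 'a
    by simp
  have CHAR: "CHAR('a) > 1"
    using prime_CHAR_finite_field prime_gt_1_nat by blast
  have "CARD('a) \<noteq> 1"
    by (metis UNIV_I card_1_singletonE singletonD zero_neq_one)
  then obtain k where k: "m = Suc k"
    using card by (cases m) auto
  define P where "P = (\<Sum>i<m. Polynomial.monom (1::'a) (CHAR('a) ^ i))"
  have "Polynomial.coeff P 1 = (\<Sum>i<m. if i = 0 then 1 else 0)"
    unfolding P_def coeff_sum using CHAR by (intro sum.cong) auto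
  also have "\<dots> = 1"
    using k by simp
  finally have "P \<noteq> 0"
    by auto
  then have "card {x. poly P x = 0} \<le> Polynomial.degree P"
    by (rule card_poly_roots_bound)
  also have "\<dots> \<le> CHAR('a) ^ k"
    unfolding P_def using CHAR
    by (intro degree_sum_le) (auto intro!: order.trans[OF degree_monom_le] power_increasing simp: k)
  also have "poly P x = 0" for x
    using trace[of x] by (simp add: P_def poly_sum poly_monom frobenius_trace_def)
  then have "{x. poly P x = 0} = UNIV"
    by simp
  finally have "CHAR('a) ^ m \<le> CHAR('a) ^ k"
    using card by simp
  then show False
    using CHAR by (simp add: k)
qed

section \<open>Cayley graphs of abelian groups\<close>

definition cayley_graph :: "'a::ab_group_add set \<Rightarrow> 'a \<Rightarrow> 'a \<Rightarrow> bool" where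
  "cayley_graph S u v \<longleftrightarrow> v - u \<in> S"

lemma graph_connected_cayley_graphI:
  assumes reachable: "\<And>v. (cayley_graph S)\<^sup>*\<^sup>* 0 v"
  shows "graph_connected (cayley_graph S)"
proof -
  have "(cayley_graph S)\<^sup>*\<^sup>* (u + 0) (u + w)" for u w
    using reachable[of w]
  proof (induction rule: rtranclp_induct)
    case (step y z)
    then have "cayley_graph S (u + y) (u + z)"
      by (simp add: cayley_graph_def)
    then show ?case
      using step.IH by (rule rtranclp.rtrancl_into_rtrancl[rotated])
  qed simp
  from this[of _ "_ - _"] show ?thesis
    unfolding graph_connected_def by (metis add_0_right add.commute diff_add_cancel)
qed

definition sum_representations :: "'a::plus set \<Rightarrow> 'a \<Rightarrow> ('a \<times> 'a) set" where
  "sum_representations S d = {(x, y) \<in> S \<times> S. x + y = d}"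

lemma card_neighbours_cayley_graph: "card {w. cayley_graph S u w} = card S"
  by (rule bij_betw_same_card, rule bij_betw_byWitness[where f = "\<lambda>w. w - u" and f' = "\<lambda>x. u + x"])
    (auto simp: cayley_graph_def)

lemma card_common_neighbours_cayley_graph:
  assumes sym: "\<And>x. x \<in> S \<Longrightarrow> - x \<in> S"
  shows "card {w. cayley_graph S u w \<and> cayley_graph S v w} = card (sum_representations S (v - u))"
proof (rule bij_betw_same_card)
  show "bij_betw (\<lambda>w. (w - u, v - w)) {w. cayley_graph S u w \<and> cayley_graph S v w}
      (sum_representations S (v - u))"
  proof (rule bij_betw_byWitness[where f' = "\<lambda>(x, y). u + x"])
    have "v - w \<in> S" if "w - v \<in> S" for w
      using sym[OF that] by simp
    then show "(\<lambda>w. (w - u, v - w)) ` {w. cayley_graph S u w \<and> cayley_graph S v w}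
        \<subseteq> sum_representations S (v - u)"
      by (auto simp: cayley_graph_def sum_representations_def)
    have solve: "y = v - (u + x)" if "x + y = v - u" for x y
      using that by (metis add_diff_cancel_left' diff_diff_eq)
    then show "\<forall>p\<in>sum_representations S (v - u).
        ((case p of (x, y) \<Rightarrow> u + x) - u, v - (case p of (x, y) \<Rightarrow> u + x)) = p"
      by (auto simp: sum_representations_def)
    have "u + x - v \<in> S" if "x + y = v - u" "y \<in> S" for x y
    proof -
      have "u + x - v = - y"
        using solve[OF that(1)] by simp
      then show ?thesis
        using sym[OF that(2)] by simp
    qed
    then show "(\<lambda>(x, y). u + x) ` sum_representations S (v - u)
        \<subseteq> {w. cayley_graph S u w \<and> cayley_graph S v w}"
      by (auto simp: cayley_graph_def sum_representations_def)
  qed auto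
qed

lemma strongly_regular_cayley_graphI:
  fixes S :: "'a::{ab_group_add,finite} set"
  assumes sym: "\<And>x. x \<in> S \<Longrightarrow> - x \<in> S" and "0 \<notin> S"
    and l: "\<And>d. d \<in> S \<Longrightarrow> card (sum_representations S d) = l"
    and m: "\<And>d. d \<noteq> 0 \<Longrightarrow> d \<notin> S \<Longrightarrow> card (sum_representations S d) = m"
  shows "strongly_regular (cayley_graph S)"
proof -
  have common: "card {w. cayley_graph S u w \<and> cayley_graph S v w} =
      card (sum_representations S (v - u))" for u v
    by (rule card_common_neighbours_cayley_graph) (rule sym)
  show ?thesis
    unfolding strongly_regular_def common card_neighbours_cayley_graph
  proof (intro conjI allI)
    show "cayley_graph S u v \<longleftrightarrow> cayley_graph S v u" for u v
      using sym[of "v - u"] sym[of "u - v"] by (auto simp: cayley_graph_def)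
    show "\<not> cayley_graph S u u" for u
      using \<open>0 \<notin> S\<close> by (simp add: cayley_graph_def)
    have "card (sum_representations S (v - u)) = l" if "cayley_graph S u v" for u v
      using that l by (simp add: cayley_graph_def)
    moreover have "card (sum_representations S (v - u)) = m"
      if "u \<noteq> v" "\<not> cayley_graph S u v" for u v
      using that m by (simp add: cayley_graph_def)
    ultimately show "\<exists>k l m. (\<forall>u::'a. card S = k) \<and>
        (\<forall>u v. cayley_graph S u v \<longrightarrow> card (sum_representations S (v - u)) = l) \<and>
        (\<forall>u v. u \<noteq> v \<and> \<not> cayley_graph S u v \<longrightarrow> card (sum_representations S (v - u)) = m)"
      by blast
  qed
qed

section \<open>Additive characters of finite fields\<close>

lemma power_cong_if_power_eq_1:
  fixes z :: "'a::monoid_mult"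
  assumes "z ^ n = 1" "[j = k] (mod n)"
  shows "z ^ j = z ^ k"
proof -
  have "z ^ i = z ^ (i mod n)" for i
  proof -
    have "z ^ i = z ^ (n * (i div n) + i mod n)"
      by simp
    also have "\<dots> = z ^ (i mod n)"
      unfolding power_add power_mult using assms(1) by simp
    finally show ?thesis .
  qed
  then show ?thesis
    using assms(2) by (metis cong_def)
qed

lemma power_eq_1_iff_prime_dvd:
  fixes z :: "'a::monoid_mult"
  assumes p: "prime p" and z: "z ^ p = 1" "z \<noteq> 1"
  shows "z ^ k = 1 \<longleftrightarrow> p dvd k"
proof
  assume k: "z ^ k = 1"
  show "p dvd k"
  proof (rule ccontr)
    assume "\<not> p dvd k"
    then have "coprime k p"
      using p prime_imp_coprime coprime_commute by blast
    then obtain i where "[k * i = 1] (mod p)"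
      using cong_solve_coprime_nat by auto
    then have "z ^ (k * i) = z ^ 1"
      by (rule power_cong_if_power_eq_1[OF z(1)])
    then show False
      using k z(2) by (simp add: power_mult)
  qed
next
  assume "p dvd k"
  then show "z ^ k = 1"
    using z(1) by (auto simp: power_mult)
qed

lemma prime_root_of_unity_powers:
  fixes z w :: complex
  assumes p: "prime p" and z: "z ^ p = 1" "z \<noteq> 1" and w: "w ^ p = 1"
  obtains k where "k < p" "w = z ^ k"
proof -
  have "z \<noteq> 0"
    using z(1) p prime_gt_0_nat[of p] by (auto simp: power_0_left)
  have inj: "inj_on (\<lambda>k. z ^ k) {..<p}"
  proof (rule linorder_inj_onI')
    fix j k assume "j \<in> {..<p}" "k \<in> {..<p}" "j < k"
    then have "\<not> p dvd k - j"
      by (intro nat_dvd_not_less) auto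
    moreover have "z ^ k = z ^ j * z ^ (k - j)"
      using \<open>j < k\<close> by (simp flip: power_add)
    ultimately show "z ^ j \<noteq> z ^ k"
      using \<open>z \<noteq> 0\<close> power_eq_1_iff_prime_dvd[OF p z] by auto
  qed
  have "(\<lambda>k. z ^ k) ` {..<p} = {w. w ^ p = 1}"
  proof (rule card_subset_eq)
    show "finite {w::complex. w ^ p = 1}"
      using p prime_gt_0_nat by (intro finite_nth_roots) auto
    have "(z ^ k) ^ p = 1" for k
      using z(1) by (metis mult.commute power_mult power_one)
    then show "(\<lambda>k. z ^ k) ` {..<p} \<subseteq> {w. w ^ p = 1}"
      by auto
    show "card ((\<lambda>k. z ^ k) ` {..<p}) = card {w::complex. w ^ p = 1}"
      using p prime_gt_0_nat[of p] by (simp add: card_image inj card_roots_unity_eq)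
  qed
  then show ?thesis
    using w that by blast
qed

locale additive_character =
  fixes \<psi> :: "'a::{field,finite} \<Rightarrow> complex"
  assumes psi_0 [simp]: "\<psi> 0 = 1" and psi_add: "\<psi> (x + y) = \<psi> x * \<psi> y"
    and nontrivial: "\<exists>x. \<psi> x \<noteq> 1"
begin

lemma psi_of_nat_mult: "\<psi> (of_nat k * x) = \<psi> x ^ k"
  by (induction k) (simp_all add: distrib_right psi_add)

lemma psi_root_of_unity: "\<psi> x ^ CHAR('a) = 1"
  using psi_of_nat_mult[of "CHAR('a)" x] by simp

lemma norm_psi: "norm (\<psi> x) = 1"
proof -
  have "norm (\<psi> x) ^ CHAR('a) = 1"
    using psi_root_of_unity[of x] by (metis norm_one norm_power)
  then show ?thesis
    using finite_imp_CHAR_pos[where ?'a = 'a] power_eq_imp_eq_base[of "norm (\<psi> x)" "CHAR('a)" 1]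
    by simp
qed

lemma psi_uminus: "\<psi> (- x) = cnj (\<psi> x)"
proof -
  have "\<psi> x * \<psi> (- x) = 1"
    using psi_add[of x "- x"] by simp
  moreover have "\<psi> x * cnj (\<psi> x) = 1"
    using complex_norm_square[of "\<psi> x"] norm_psi[of x] by simp
  moreover have "\<psi> x \<noteq> 0"
    using norm_psi[of x] by auto
  ultimately show ?thesis
    by (metis mult_left_cancel)
qed

lemma sum_psi: "(\<Sum>b\<in>UNIV. \<psi> (b * a)) = (if a = 0 then of_nat CARD('a) else 0)"
proof (cases "a = 0")
  case False
  obtain z where z: "\<psi> z \<noteq> 1"
    using nontrivial by blast
  have "(\<Sum>b\<in>UNIV. \<psi> (b * a)) = (\<Sum>b\<in>UNIV. \<psi> ((b + z / a) * a))"
    by (rule sum.reindex_bij_witness[of _ "\<lambda>b. b + z / a" "\<lambda>b. b - z / a"]) auto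
  also have "\<dots> = (\<Sum>b\<in>UNIV. \<psi> (b * a)) * \<psi> z"
    using False by (simp add: distrib_right psi_add sum_distrib_right)
  finally have "(1 - \<psi> z) * (\<Sum>b\<in>UNIV. \<psi> (b * a)) = 0"
    by (simp add: algebra_simps)
  then show ?thesis
    using z False by simp
qed simp

definition exp_sum :: "'s set \<Rightarrow> ('s \<Rightarrow> 'a) \<Rightarrow> 'a \<Rightarrow> complex" where
  "exp_sum S f b = (\<Sum>s\<in>S. \<psi> (b * f s))"

abbreviation char_sum :: "'a set \<Rightarrow> 'a \<Rightarrow> complex" where
  "char_sum S \<equiv> exp_sum S (\<lambda>x. x)"

lemma exp_sum_0 [simp]: "exp_sum S f 0 = of_nat (card S)"
  by (simp add: exp_sum_def)

lemma exp_sum_shift: "exp_sum S (\<lambda>s. f s + a) b = \<psi> (b * a) * exp_sum S f b"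
  unfolding exp_sum_def sum_distrib_left by (simp add: distrib_left psi_add mult.commute)

lemma exp_sum_mult: "exp_sum S f b * exp_sum T g b = exp_sum (S \<times> T) (\<lambda>(s, t). f s + g t) b"
  unfolding exp_sum_def sum_product sum.cartesian_product
  by (intro sum.cong) (auto simp: distrib_left psi_add)

lemma sum_exp_sum:
  assumes "finite S"
  shows "(\<Sum>b\<in>UNIV. exp_sum S f b) = of_nat (CARD('a) * card {s \<in> S. f s = 0})"
proof -
  have "(\<Sum>b\<in>UNIV. exp_sum S f b) = (\<Sum>s\<in>S. \<Sum>b\<in>UNIV. \<psi> (b * f s))"
    unfolding exp_sum_def by (rule sum.swap)
  also have "\<dots> = (\<Sum>s\<in>{s \<in> S. f s = 0}. of_nat CARD('a))"
    unfolding sum_psi using assms by (intro sum.mono_neutral_cong_right) auto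
  finally show ?thesis
    by (simp add: mult.commute)
qed

lemma cnj_char_sum:
  assumes "\<And>x. x \<in> S \<Longrightarrow> - x \<in> S"
  shows "cnj (char_sum S b) = char_sum S b"
proof -
  have "cnj (char_sum S b) = (\<Sum>x\<in>S. \<psi> (b * - x))"
    by (simp add: exp_sum_def psi_uminus)
  also have "\<dots> = char_sum S b"
    unfolding exp_sum_def using assms by (intro sum.reindex_bij_witness[of _ uminus uminus]) auto
  finally show ?thesis .
qed

text \<open>The Hartley kernel: for symmetric \<open>S\<close> it provides a real eigenbasis, where the characters
  themselves only provide a complex one.\<close>

definition cas :: "'a \<Rightarrow> real" where
  "cas x = Re (\<psi> x) + Im (\<psi> x)"

lemma cas_orthogonal: "(\<Sum>b\<in>UNIV. cas (u * b) * cas (v * b)) = (if u = v then real CARD('a) else 0)"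
proof -
  have "cas (u * b) * cas (v * b) = Re (\<psi> (b * (u - v))) + Im (\<psi> (b * (u + v)))" for b
  proof -
    have "\<psi> (b * (u - v)) = \<psi> (u * b) * cnj (\<psi> (v * b))"
      using psi_add[of "u * b" "- (v * b)"] by (simp add: psi_uminus algebra_simps)
    moreover have "\<psi> (b * (u + v)) = \<psi> (u * b) * \<psi> (v * b)"
      using psi_add[of "u * b" "v * b"] by (simp add: algebra_simps)
    ultimately show ?thesis
      by (simp add: cas_def algebra_simps)
  qed
  then have "(\<Sum>b\<in>UNIV. cas (u * b) * cas (v * b)) =
      Re (\<Sum>b\<in>UNIV. \<psi> (b * (u - v))) + Im (\<Sum>b\<in>UNIV. \<psi> (b * (u + v)))"
    by (simp add: sum.distrib)
  then show ?thesis
    by (simp add: sum_psi)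
qed

lemma cas_eigenvector:
  assumes sym: "\<And>x. x \<in> S \<Longrightarrow> - x \<in> S"
  shows "(\<Sum>v\<in>UNIV. adj_matrix (cayley_graph S) $ u $ v * cas (v * b)) =
      Re (char_sum S b) * cas (u * b)"
proof -
  have "(\<Sum>v\<in>UNIV. adj_matrix (cayley_graph S) $ u $ v * cas (v * b)) =
      (\<Sum>v\<in>{v. v - u \<in> S}. cas (v * b))"
    by (intro sum.mono_neutral_cong_right) (auto simp: adj_matrix_def cayley_graph_def)
  also have "\<dots> = (\<Sum>x\<in>S. cas (b * (x + u)))"
    by (rule sum.reindex_bij_witness[of _ "\<lambda>x. x + u" "\<lambda>v. v - u"]) (auto simp: mult.commute)
  also have "\<dots> = Re (exp_sum S (\<lambda>x. x + u) b) + Im (exp_sum S (\<lambda>x. x + u) b)"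
    by (simp add: exp_sum_def cas_def sum.distrib)
  also have "\<dots> = Re (char_sum S b) * cas (u * b)"
  proof -
    have "Im (char_sum S b) = 0"
      using cnj_char_sum[OF sym] by (metis Reals_cnj_iff complex_is_Real_iff)
    then show ?thesis
      by (simp add: exp_sum_shift cas_def algebra_simps)
  qed
  finally show ?thesis .
qed

lemma is_spectrum_cayley_graph:
  assumes "\<And>x. x \<in> S \<Longrightarrow> - x \<in> S"
  shows "is_spectrum (adj_matrix (cayley_graph S))
    (image_mset (\<lambda>b. Re (char_sum S b)) (mset_set UNIV))"
  by (rule is_spectrum_if_orthogonal_eigenbasis[where H = "\<lambda>u b. cas (u * b)"
        and c = "real CARD('a)"])
    (simp_all add: cas_eigenvector assms cas_orthogonal card_eq_0_iff)

lemma char_sum_eq_0_if_closed: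
  assumes closed: "\<And>v r. v \<in> V \<Longrightarrow> r \<in> S \<Longrightarrow> v + r \<in> V"
    and "char_sum S b \<noteq> of_nat (card S)"
  shows "char_sum V b = 0"
proof -
  have "\<psi> (b * r) * char_sum V b = char_sum V b" if r: "r \<in> S" for r
  proof -
    have "(\<lambda>v. v + r) ` V = V"
      by (rule endo_inj_surj) (use closed[OF _ r] in auto)
    then have "bij_betw (\<lambda>v. v + r) V V"
      by (simp add: bij_betw_def)
    then have "exp_sum V (\<lambda>v. v + r) b = char_sum V b"
      unfolding exp_sum_def by (rule sum.reindex_bij_betw)
    then show ?thesis
      by (simp add: exp_sum_shift)
  qed
  then have "(\<Sum>r\<in>S. \<psi> (b * r) * char_sum V b) = (\<Sum>r\<in>S. char_sum V b)"
    by (rule sum.cong[OF refl])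
  then have "char_sum S b * char_sum V b = of_nat (card S) * char_sum V b"
    by (simp add: exp_sum_def[of S] flip: sum_distrib_right)
  then show ?thesis
    using assms(2) by simp
qed

lemma eq_UNIV_if_char_sum_eq_0:
  assumes "0 \<in> V" and vanish: "\<And>b. b \<noteq> 0 \<Longrightarrow> char_sum V b = 0"
  shows "V = UNIV"
proof -
  have "of_nat (card V) = (\<Sum>b\<in>UNIV. if b = (0::'a) then char_sum V 0 else 0)"
    by simp
  also have "\<dots> = (\<Sum>b\<in>UNIV. char_sum V b)"
    using vanish by (intro sum.cong) auto
  also have "\<dots> = of_nat (CARD('a) * card {v \<in> V. v = 0})"
    by (rule sum_exp_sum) simp
  also have "{v \<in> V. v = 0} = {0}"
    using \<open>0 \<in> V\<close> by auto
  finally have "card V = CARD('a)"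
    by (simp only: of_nat_eq_iff) simp
  then show ?thesis
    by (intro card_subset_eq) auto
qed

lemma graph_connected_cayley_graph:
  assumes "\<And>b. b \<noteq> 0 \<Longrightarrow> char_sum S b \<noteq> of_nat (card S)"
  shows "graph_connected (cayley_graph S)"
proof -
  define V where "V = {v. (cayley_graph S)\<^sup>*\<^sup>* 0 v}"
  have "v + r \<in> V" if "v \<in> V" "r \<in> S" for v r
    using that by (auto simp: V_def cayley_graph_def intro: rtranclp.rtrancl_into_rtrancl)
  then have "char_sum V b = 0" if "b \<noteq> 0" for b
    using assms[OF that] by (rule char_sum_eq_0_if_closed)
  then have "V = UNIV"
    by (intro eq_UNIV_if_char_sum_eq_0) (auto simp: V_def)
  then show ?thesis
    by (intro graph_connected_cayley_graphI) (auto simp: V_def)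
qed

lemma sum_char_sum_psi:
  "(\<Sum>b\<in>UNIV. \<psi> (b * - d) * char_sum S b) = (if d \<in> S then of_nat CARD('a) else 0)"
proof -
  have "(\<Sum>b\<in>UNIV. \<psi> (b * - d) * char_sum S b) = (\<Sum>b\<in>UNIV. exp_sum S (\<lambda>x. x + - d) b)"
    by (simp only: exp_sum_shift)
  also have "\<dots> = of_nat (CARD('a) * card {x \<in> S. x + - d = 0})"
    by (rule sum_exp_sum) simp
  also have "{x \<in> S. x + - d = 0} = (if d \<in> S then {d} else {})"
    by auto
  finally show ?thesis
    by simp
qed

lemma sum_char_sum_sq_psi:
  "(\<Sum>b\<in>UNIV. (char_sum S b)\<^sup>2 * \<psi> (b * - d)) = of_nat (CARD('a) * card (sum_representations S d))"
proof -
  have "(\<Sum>b\<in>UNIV. (char_sum S b)\<^sup>2 * \<psi> (b * - d)) =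
      (\<Sum>b\<in>UNIV. exp_sum (S \<times> S) (\<lambda>p. (case p of (x, y) \<Rightarrow> x + y) + - d) b)"
    unfolding exp_sum_shift power2_eq_square exp_sum_mult by (simp only: mult.commute)
  also have "\<dots> = of_nat (CARD('a) * card {p \<in> S \<times> S. (case p of (x, y) \<Rightarrow> x + y) + - d = 0})"
    by (rule sum_exp_sum) simp
  also have "{p \<in> S \<times> S. (case p of (x, y) \<Rightarrow> x + y) + - d = 0} = sum_representations S d"
    by (auto simp: sum_representations_def)
  finally show ?thesis .
qed

lemma card_sum_representations:
  assumes two: "\<And>b. b \<noteq> 0 \<Longrightarrow> char_sum S b = r \<or> char_sum S b = s" and d: "d \<noteq> 0"
  shows "of_nat (card (sum_representations S d)) =
    (of_nat (card S) - r) * (of_nat (card S) - s) / of_nat CARD('a) + (if d \<in> S then r + s else 0)"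
proof -
  let ?K = "(of_nat (card S) - r) * (of_nat (card S) - s)"
  have square: "(char_sum S b)\<^sup>2 * \<psi> (b * - d) =
      (if b = (0::'a) then ?K else 0) + (r + s) * (\<psi> (b * - d) * char_sum S b)
        - r * s * \<psi> (b * - d)"
    for b
  proof (cases "b = 0")
    case True
    then show ?thesis
      by (simp add: power2_eq_square algebra_simps)
  next
    case False
    have "(char_sum S b - r) * (char_sum S b - s) = 0"
      using two[OF False] by auto
    then have "(char_sum S b)\<^sup>2 = (r + s) * char_sum S b - r * s"
      by (simp add: power2_eq_square algebra_simps)
    then show ?thesis
      using False by (simp add: left_diff_distrib right_diff_distrib mult_ac)
  qed
  have "of_nat (CARD('a) * card (sum_representations S d)) =
      (\<Sum>b\<in>UNIV. if b = (0::'a) then ?K else 0)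
      + (r + s) * (\<Sum>b\<in>UNIV. \<psi> (b * - d) * char_sum S b) - r * s * (\<Sum>b\<in>UNIV. \<psi> (b * - d))"
    unfolding sum_char_sum_sq_psi[symmetric] square sum_subtractf sum.distrib sum_distrib_left ..
  also have "\<dots> = ?K + (r + s) * (if d \<in> S then of_nat CARD('a) else 0)"
    using d by (simp only: sum_psi sum_char_sum_psi) simp
  finally show ?thesis
    by (simp add: field_simps split: if_splits)
qed

lemma strongly_regular_cayley_graph:
  assumes "\<And>x. x \<in> S \<Longrightarrow> - x \<in> S" "0 \<notin> S"
    and two: "\<And>b. b \<noteq> 0 \<Longrightarrow> char_sum S b = r \<or> char_sum S b = s"
  shows "strongly_regular (cayley_graph S)"
proof -
  let ?K = "(of_nat (card S) - r) * (of_nat (card S) - s) / of_nat CARD('a)"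
  have count: "card (sum_representations S d) = nat \<lfloor>Re (?K + (if d \<in> S then r + s else 0))\<rfloor>"
    if "d \<noteq> 0" for d
  proof -
    have "of_nat (card (sum_representations S d)) = ?K + (if d \<in> S then r + s else 0)"
      using two that by (rule card_sum_representations)
    from arg_cong[OF this, of "\<lambda>z. nat \<lfloor>Re z\<rfloor>"] show ?thesis
      by (simp only: complex_Re_of_nat floor_of_nat nat_int)
  qed
  show ?thesis
  proof (rule strongly_regular_cayley_graphI)
    show "card (sum_representations S d) = nat \<lfloor>Re (?K + (r + s))\<rfloor>" if "d \<in> S" for d
      using that \<open>0 \<notin> S\<close> count[of d] by auto
    show "card (sum_representations S d) = nat \<lfloor>Re ?K\<rfloor>" if "d \<noteq> 0" "d \<notin> S" for d
      using that count[of d] by simp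
  qed (use assms in auto)
qed

lemma card_psi_fibre_le:
  assumes closed: "\<And>x. x \<in> S \<Longrightarrow> of_nat k * x \<in> S" and k: "0 < k" "k < CHAR('a)"
  shows "card {x \<in> S. \<psi> (b * x) = z} \<le> card {x \<in> S. \<psi> (b * x) = z ^ k}"
proof (rule card_inj_on_le)
  have "of_nat k \<noteq> (0::'a)"
    using k nat_dvd_not_less by (simp add: of_nat_eq_0_iff_char_dvd)
  then show "inj_on ((*) (of_nat k)) {x \<in> S. \<psi> (b * x) = z}"
    by (intro inj_onI) simp
  have "\<psi> (b * (of_nat k * x)) = \<psi> (b * x) ^ k" for x
    using psi_of_nat_mult[of k "b * x"] by (simp add: mult.left_commute)
  then show "(*) (of_nat k) ` {x \<in> S. \<psi> (b * x) = z} \<subseteq> {x \<in> S. \<psi> (b * x) = z ^ k}"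
    using closed by auto
qed simp

text \<open>Scaling by the prime field permutes the nontrivial roots of unity, so each of them is taken
  equally often by \<open>\<psi> (b * x)\<close> as \<open>x\<close> runs through \<open>S\<close>.\<close>

lemma char_sum_in_Ints:
  assumes closed: "\<And>k x. 0 < k \<Longrightarrow> k < CHAR('a) \<Longrightarrow> x \<in> S \<Longrightarrow> of_nat k * x \<in> S"
  shows "char_sum S b \<in> \<int>"
proof -
  define N where "N z = card {x \<in> S. \<psi> (b * x) = z}" for z
  let ?U = "{z::complex. z ^ CHAR('a) = 1}"
  have p: "prime CHAR('a)"
    by (rule prime_CHAR_finite_field)
  have U: "finite ?U" "\<Sum>?U = 0"
    using p prime_gt_1_nat[of "CHAR('a)"] by (simp_all add: finite_nth_roots sum_roots_unity)
  have "N z \<le> N w" if "z \<in> ?U - {1}" "w \<in> ?U - {1}" for z w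
  proof -
    obtain k where k: "k < CHAR('a)" "w = z ^ k"
      using prime_root_of_unity_powers[OF p, of z w] \<open>z \<in> ?U - {1}\<close> \<open>w \<in> ?U - {1}\<close> by auto
    then have "0 < k"
      using that(2) by (cases k) auto
    then show ?thesis
      unfolding N_def k(2) using closed k(1) by (intro card_psi_fibre_le) auto
  qed
  then obtain M where M: "\<And>z. z \<in> ?U - {1} \<Longrightarrow> N z = M"
    by (metis antisym)
  have "char_sum S b = (\<Sum>z\<in>?U. \<Sum>x\<in>{x \<in> S. \<psi> (b * x) = z}. \<psi> (b * x))"
    unfolding exp_sum_def by (rule sum.group[symmetric]) (use U(1) psi_root_of_unity in auto)
  also have "\<dots> = (\<Sum>z\<in>?U. of_nat (N z) * z)"
    by (simp add: N_def)
  also have "\<dots> = of_nat (N 1) + (\<Sum>z\<in>?U - {1}. of_nat (N z) * z)"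
    using U(1) by (subst sum.remove[of _ 1]) auto
  also have "(\<Sum>z\<in>?U - {1}. of_nat (N z) * z) = of_nat M * (\<Sum>z\<in>?U - {1}. z)"
    using M by (simp add: sum_distrib_left)
  also have "(\<Sum>z\<in>?U - {1}. z) = - 1"
    using U sum.remove[of ?U 1 "\<lambda>z. z"] by (simp add: eq_neg_iff_add_eq_0 add.commute)
  finally show ?thesis
    by simp
qed

end

lemma ex_additive_character:
  assumes card: "CARD('a::{field,finite}) = CHAR('a) ^ m"
  shows "\<exists>\<psi>::'a \<Rightarrow> complex. additive_character \<psi>"
proof -
  note p = prime_CHAR_finite_field[where ?'a = 'a]
  have "frobenius_trace m x \<in> {y. y ^ CHAR('a) = y}" for x :: 'a
    using frobenius_trace_power_CHAR[OF card, of x] by simp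
  then have "frobenius_trace m x \<in> of_nat ` {..<CHAR('a)}" for x :: 'a
    unfolding prime_field_eq[OF p] .
  then have "\<forall>x::'a. \<exists>k. frobenius_trace m x = of_nat k"
    by blast
  then obtain T where T: "\<And>x::'a. frobenius_trace m x = of_nat (T x)"
    by metis
  have "card {z::complex. z ^ CHAR('a) = 1} > card {1::complex}"
    using prime_gt_1_nat[OF p] by (simp add: card_roots_unity_eq)
  then have "\<not> {z::complex. z ^ CHAR('a) = 1} \<subseteq> {1}"
    using card_mono[of "{1::complex}" "{z. z ^ CHAR('a) = 1}"] by auto
  then obtain \<zeta> :: complex where \<zeta>: "\<zeta> ^ CHAR('a) = 1" "\<zeta> \<noteq> 1"
    by blast
  have root: "\<zeta> ^ T x = 1 \<longleftrightarrow> frobenius_trace m x = 0" for x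
    unfolding T power_eq_1_iff_prime_dvd[OF p \<zeta>] by (simp add: of_nat_eq_0_iff_char_dvd)
  have "additive_character (\<lambda>x. \<zeta> ^ T x)"
  proof
    show "\<zeta> ^ T 0 = 1"
      using prime_gt_0_nat[OF p] by (simp add: root frobenius_trace_def power_0_left)
    show "\<exists>x. \<zeta> ^ T x \<noteq> 1"
      using ex_frobenius_trace_neq_0[OF card] by (simp add: root)
  next
    fix x y
    have "of_nat (T (x + y)) = (of_nat (T x + T y) :: 'a)"
      using frobenius_trace_add[OF p, of m x y] by (simp add: T)
    then have "\<zeta> ^ T (x + y) = \<zeta> ^ (T x + T y)"
      by (intro power_cong_if_power_eq_1[OF \<zeta>(1)]) (simp only: of_nat_eq_iff_cong_CHAR)
    then show "\<zeta> ^ T (x + y) = \<zeta> ^ T x * \<zeta> ^ T y"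
      by (simp add: power_add)
  qed
  then show ?thesis
    by blast
qed

section \<open>Cubes in a finite field\<close>

lemma zero_notin_cubes: "0 \<notin> cubes"
  by (auto simp: cubes_def)

lemma cubes_mult: "x \<in> cubes \<Longrightarrow> y \<in> cubes \<Longrightarrow> x * y \<in> cubes"
  unfolding cubes_def by clarsimp (metis mult_eq_0_iff power_mult_distrib)

lemma cubes_uminus: "x \<in> cubes \<Longrightarrow> - x \<in> cubes"
  unfolding cubes_def by clarsimp (metis neg_equal_0_iff_equal power_minus_odd odd_numeral)

lemma cayley3_eq_cayley_graph: "cayley3 = cayley_graph cubes"
  by (simp add: fun_eq_iff cayley3_def cayley_graph_def)

lemma cube_root_of_unity_sum:
  fixes w :: "'a::idom"
  assumes "w ^ 3 = 1" "w \<noteq> 1"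
  shows "1 + w + w\<^sup>2 = 0"
proof -
  have "(w - 1) * (1 + w + w\<^sup>2) = w ^ 3 - 1"
    by (simp add: power2_eq_square power3_eq_cube algebra_simps)
  then show ?thesis
    using assms by simp
qed

locale cubic_field =
  fixes F :: "'a::{field,finite} itself" and n :: nat
  assumes card_field: "CARD('a) = 3 * n + 1"
begin

lemma n_pos: "n > 0"
proof (rule ccontr)
  assume "\<not> n > 0"
  then have "CARD('a) = 1"
    using card_field by simp
  then show False
    by (metis UNIV_I card_1_singletonE singletonD zero_neq_one)
qed

lemma power_3n: "x \<noteq> 0 \<Longrightarrow> x ^ (3 * n) = (1::'a)"
  using power_CARD_minus_1[of x] card_field by simp

lemma power_n_cube: "x \<noteq> 0 \<Longrightarrow> (x ^ n) ^ 3 = (1::'a)"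
  using power_3n[of x] by (simp add: mult.commute flip: power_mult)

definition noncube :: 'a (\<open>\<gamma>\<close>) where
  "\<gamma> = (SOME y. y \<noteq> 0 \<and> y ^ n \<noteq> 1)"

definition omega :: 'a (\<open>\<omega>\<close>) where
  "\<omega> = \<gamma> ^ n"

lemma noncube_nonzero: "\<gamma> \<noteq> 0" and omega_neq_1: "\<omega> \<noteq> 1"
proof -
  have "\<exists>y::'a. y \<noteq> 0 \<and> y ^ n \<noteq> 1"
    using ex_nonzero_power_neq_1[where ?'a = 'a, of n] n_pos card_field by simp
  from someI_ex[OF this] show "\<gamma> \<noteq> 0" "\<omega> \<noteq> 1"
    by (auto simp: noncube_def omega_def)
qed

lemma omega_cube: "\<omega> ^ 3 = 1"
  unfolding omega_def using noncube_nonzero by (rule power_n_cube)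

lemma omega_distinct: "\<omega> \<noteq> 0" "\<omega>\<^sup>2 \<noteq> 1" "\<omega>\<^sup>2 \<noteq> \<omega>"
proof -
  show nonzero: "\<omega> \<noteq> 0"
    using omega_cube by auto
  show "\<omega>\<^sup>2 \<noteq> 1"
    using omega_cube omega_neq_1 by (auto simp: power2_eq_square power3_eq_cube)
  show "\<omega>\<^sup>2 \<noteq> \<omega>"
    using nonzero omega_neq_1 by (auto simp: power2_eq_square)
qed

lemma cube_eq_iff: "x ^ 3 = y ^ 3 \<longleftrightarrow> x = y \<or> x = \<omega> * y \<or> x = \<omega>\<^sup>2 * y"
proof -
  have "(x - y) * ((x - \<omega> * y) * (x - \<omega>\<^sup>2 * y))
      = x ^ 3 - (1 + \<omega> + \<omega>\<^sup>2) * x\<^sup>2 * y + \<omega> * (1 + \<omega> + \<omega>\<^sup>2) * x * y\<^sup>2 - \<omega> ^ 3 * y ^ 3"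
    by (simp add: power2_eq_square power3_eq_cube algebra_simps)
  also have "\<dots> = x ^ 3 - y ^ 3"
    by (simp add: cube_root_of_unity_sum[OF omega_cube omega_neq_1] omega_cube)
  finally have "x ^ 3 - y ^ 3 = 0 \<longleftrightarrow> x - y = 0 \<or> x - \<omega> * y = 0 \<or> x - \<omega>\<^sup>2 * y = 0"
    by (metis mult_eq_0_iff)
  then show ?thesis
    by simp
qed

lemma card_cube_roots:
  fixes y :: 'a
  assumes "y \<noteq> 0"
  shows "card {x. x ^ 3 = y ^ 3} = 3"
proof -
  have "{x. x ^ 3 = y ^ 3} = {y, \<omega> * y, \<omega>\<^sup>2 * y}"
    using cube_eq_iff by auto
  moreover have "y \<noteq> \<omega> * y" "y \<noteq> \<omega>\<^sup>2 * y" "\<omega> * y \<noteq> \<omega>\<^sup>2 * y"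
    using assms omega_neq_1 omega_distinct by (metis mult_cancel_right mult_1)+
  ultimately show ?thesis
    by simp
qed

lemma sum_over_cubes:
  fixes f :: "'a \<Rightarrow> 'b::comm_semiring_1"
  shows "(\<Sum>x\<in>UNIV. f (x ^ 3)) = f 0 + 3 * (\<Sum>y\<in>cubes. f y)"
proof -
  have "(\<Sum>x\<in>UNIV. f (x ^ 3)) = f 0 + (\<Sum>x\<in>UNIV - {0}. f (x ^ 3))"
    by (subst sum.remove[of UNIV 0]) auto
  also have "(\<Sum>x\<in>UNIV - {0}. f (x ^ 3)) = (\<Sum>y\<in>cubes. \<Sum>x\<in>{x \<in> UNIV - {0}. x ^ 3 = y}. f (x ^ 3))"
    by (rule sum.group[symmetric]) (auto simp: cubes_def)
  also have "\<dots> = (\<Sum>y\<in>cubes. 3 * f y)"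
  proof (rule sum.cong[OF refl])
    fix y :: 'a
    assume "y \<in> cubes"
    then obtain z where z: "z \<noteq> 0" "y = z ^ 3"
      by (auto simp: cubes_def)
    then have "{x \<in> UNIV - {0}. x ^ 3 = y} = {x. x ^ 3 = z ^ 3}"
      by (auto simp: zero_power)
    then show "(\<Sum>x\<in>{x \<in> UNIV - {0}. x ^ 3 = y}. f (x ^ 3)) = 3 * f y"
      using card_cube_roots[OF z(1)] z(2) by simp
  qed
  finally show ?thesis
    by (simp add: sum_distrib_left)
qed

lemma card_cubes: "card (cubes :: 'a set) = n"
  using sum_over_cubes[of "\<lambda>_. 1::nat"] card_field by simp

lemma cubes_eq: "cubes = {x::'a. x ^ n = 1}"
proof (rule card_seteq)
  show "cubes \<subseteq> {x::'a. x ^ n = 1}"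
    using power_3n by (auto simp: cubes_def simp flip: power_mult)
  show "card {x::'a. x ^ n = 1} \<le> card (cubes :: 'a set)"
    using card_roots_of_unity_le[of n] n_pos card_cubes by simp
qed simp

lemma noncube_power_coset: "(\<lambda>r. \<gamma> ^ i * r) ` cubes = {b. b ^ n = \<omega> ^ i}"
proof (intro equalityI subsetI)
  fix b assume "b \<in> {b. b ^ n = \<omega> ^ i}"
  then have "b / \<gamma> ^ i \<in> cubes"
    using noncube_nonzero
    by (simp add: cubes_eq power_divide omega_def mult.commute flip: power_mult)
  then show "b \<in> (\<lambda>r. \<gamma> ^ i * r) ` cubes"
    using noncube_nonzero by (intro image_eqI[of _ _ "b / \<gamma> ^ i"]) auto
next
  fix b assume "b \<in> (\<lambda>r. \<gamma> ^ i * r) ` cubes"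
  then show "b \<in> {b. b ^ n = \<omega> ^ i}"
    by (auto simp: cubes_eq power_mult_distrib omega_def mult.commute simp flip: power_mult)
qed

lemma image_mset_coset_invariant:
  assumes invariant: "\<And>b r. r \<in> cubes \<Longrightarrow> f (b * r) = f b"
  shows "image_mset f (mset_set (UNIV - {0})) =
    replicate_mset n (f 1) + replicate_mset n (f \<gamma>) + replicate_mset n (f (\<gamma>\<^sup>2))"
proof -
  let ?C = "\<lambda>i. {b. b ^ n = \<omega> ^ i}"
  have coset: "image_mset f (mset_set (?C i)) = replicate_mset n (f (\<gamma> ^ i))" for i
  proof -
    have inj: "inj_on (\<lambda>r. \<gamma> ^ i * r) cubes"
      using noncube_nonzero by (auto intro!: inj_onI)
    have "image_mset f (mset_set (?C i)) =
        image_mset f (image_mset (\<lambda>r. \<gamma> ^ i * r) (mset_set cubes))"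
      by (simp add: image_mset_mset_set[OF inj] noncube_power_coset)
    also have "\<dots> = image_mset (\<lambda>r::'a. f (\<gamma> ^ i)) (mset_set cubes)"
      unfolding image_mset.compositionality
      by (intro image_mset_cong) (use invariant in auto)
    finally show ?thesis
      by (simp add: image_mset_const_eq card_cubes)
  qed
  have "b ^ n \<in> {1, \<omega>, \<omega>\<^sup>2}" if "b \<noteq> 0" for b
    using cube_eq_iff[of "b ^ n" 1] power_n_cube[OF that] by auto
  then have "UNIV - {0} = ?C 0 \<union> ?C 1 \<union> ?C 2"
    using n_pos omega_distinct by (auto simp: zero_power)
  moreover have "?C 0 \<inter> ?C 1 = {}" "(?C 0 \<union> ?C 1) \<inter> ?C 2 = {}"
    using omega_neq_1 omega_distinct by auto
  ultimately have "mset_set (UNIV - {0}) = mset_set (?C 0) + mset_set (?C 1) + mset_set (?C 2)"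
    by (simp only: mset_set_Union finite)
  then show ?thesis
    using coset[of 0] coset[of 1] coset[of 2] by simp
qed

lemma sum_coset_invariant:
  fixes f :: "'a \<Rightarrow> 'b::comm_semiring_1"
  assumes "\<And>b r. r \<in> cubes \<Longrightarrow> f (b * r) = f b"
  shows "(\<Sum>b\<in>UNIV. f b) = f 0 + of_nat n * (f 1 + f \<gamma> + f (\<gamma>\<^sup>2))"
proof -
  have "image_mset f (mset_set (UNIV - {0})) =
      replicate_mset n (f 1) + replicate_mset n (f \<gamma>) + replicate_mset n (f (\<gamma>\<^sup>2))"
    using assms by (rule image_mset_coset_invariant)
  then have "sum f (UNIV - {0}) = of_nat n * (f 1 + f \<gamma> + f (\<gamma>\<^sup>2))"
    unfolding sum_unfold_sum_mset by (simp add: distrib_left)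
  then show ?thesis
    by (subst sum.remove[of UNIV 0]) auto
qed

lemma coset_invariant_values:
  assumes "\<And>b r. r \<in> cubes \<Longrightarrow> f (b * r) = f b" and "b \<noteq> 0"
  shows "f b \<in> {f 1, f \<gamma>, f (\<gamma>\<^sup>2)}"
proof -
  have "f b \<in># image_mset f (mset_set (UNIV - {0}))"
    using \<open>b \<noteq> 0\<close> by auto
  also have "image_mset f (mset_set (UNIV - {0})) =
      replicate_mset n (f 1) + replicate_mset n (f \<gamma>) + replicate_mset n (f (\<gamma>\<^sup>2))"
    using assms(1) by (rule image_mset_coset_invariant)
  finally show ?thesis
    by (auto split: if_splits)
qed

end

definition two_cubes_count :: "'a::field \<Rightarrow> nat" where
  "two_cubes_count u = card {(x, y). x ^ 3 + y ^ 3 = u}"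

text \<open>The projective curve \<open>x\<^sup>3 + y\<^sup>3 = z\<^sup>3\<close> has three further points at infinity when 3 divides
  \<open>q - 1\<close>, so the defect is its number of points minus \<open>q + 1\<close>.\<close>

definition fermat_defect :: "'a::{field,finite} itself \<Rightarrow> int" where
  "fermat_defect F = int (two_cubes_count (1::'a)) + 2 - int CARD('a)"

lemma two_cubes_count_eq_sum:
  fixes u :: "'a::{field,finite}"
  shows "two_cubes_count u = (\<Sum>x\<in>UNIV. card {y. y ^ 3 = u - x ^ 3})"
proof -
  have "{(x, y). x ^ 3 + y ^ 3 = u} = (SIGMA x:UNIV. {y. y ^ 3 = u - x ^ 3})"
    by (auto simp: algebra_simps)
  then show ?thesis
    by (simp add: two_cubes_count_def card_SigmaI)
qed

lemma two_cubes_count_minus_cube: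
  fixes z :: "'a::field"
  assumes z: "z \<noteq> 0"
  shows "two_cubes_count (- (z ^ 3)) = two_cubes_count (1::'a)"
  unfolding two_cubes_count_def
proof (rule bij_betw_same_card[symmetric], rule bij_betw_byWitness)
  let ?f = "\<lambda>(x, y). (- z * x, - z * y)" and ?g = "\<lambda>(x, y). (x / - z, y / - z)"
  let ?A = "{(x, y). x ^ 3 + y ^ 3 = 1}" and ?B = "{(x, y). x ^ 3 + y ^ 3 = - (z ^ 3)}"
  have "(- z * x) ^ 3 + (- z * y) ^ 3 = - (z ^ 3) * (x ^ 3 + y ^ 3)" for x y
    by (simp add: power3_eq_cube algebra_simps)
  then show "?f ` ?A \<subseteq> ?B"
    by auto
  have "(x / - z) ^ 3 + (y / - z) ^ 3 = (x ^ 3 + y ^ 3) / - (z ^ 3)" for x y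
    by (simp add: power_divide add_divide_distrib power3_eq_cube)
  then show "?g ` ?B \<subseteq> ?A"
    using z by auto
  show "\<forall>p\<in>?A. ?g (?f p) = p" "\<forall>p\<in>?B. ?f (?g p) = p"
    using z by auto
qed

context cubic_field
begin

lemma two_cubes_count_0: "two_cubes_count (0::'a) = 1 + 9 * n"
proof -
  have "card {y. y ^ 3 = 0 - x ^ 3} = (if x = 0 then 1 else 3)" for x :: 'a
  proof (cases "x = 0")
    case True
    then have "{y. y ^ 3 = 0 - x ^ 3} = {0}"
      by auto
    then show ?thesis
      using True by simp
  next
    case False
    then show ?thesis
      using card_cube_roots[of "- x"] by simp
  qed
  then have "two_cubes_count (0::'a) = (\<Sum>x\<in>UNIV. if x = (0::'a) then 1 else 3)"
    by (simp add: two_cubes_count_eq_sum)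
  also have "\<dots> = 1 + (\<Sum>x\<in>UNIV - {0::'a}. 3)"
    by (subst sum.remove[of UNIV 0]) auto
  finally show ?thesis
    using card_field by simp
qed

lemma of_nat_card_cube_roots: "of_nat (card {y. y ^ 3 = u}) = (1 + u ^ n + u ^ (2 * n) :: 'a)"
proof -
  have square: "u ^ (2 * n) = (u ^ n)\<^sup>2"
    by (simp add: mult.commute flip: power_mult)
  consider "u = 0" | "u \<in> cubes" | "u \<noteq> 0" "u \<notin> cubes"
    by blast
  then show ?thesis
  proof cases
    case 1
    then have "{y. y ^ 3 = u} = {0}"
      by auto
    then show ?thesis
      using 1 n_pos by (simp add: zero_power)
  next
    case 2
    then obtain y where "y \<noteq> 0" "u = y ^ 3"
      by (auto simp: cubes_def)
    then have "card {y. y ^ 3 = u} = 3"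
      using card_cube_roots by blast
    then show ?thesis
      using 2 square by (simp add: cubes_eq)
  next
    case 3
    then have "{y. y ^ 3 = u} = {}"
      by (auto simp: cubes_def)
    moreover have "u ^ n \<noteq> 1"
      using 3 by (simp add: cubes_eq)
    then have "1 + u ^ n + (u ^ n)\<^sup>2 = 0"
      by (rule cube_root_of_unity_sum[OF power_n_cube[OF 3(1)]])
    ultimately show ?thesis
      using square by simp
  qed
qed

text \<open>In the field, the point count becomes a sum of powers of \<open>1 - x\<^sup>3\<close>, in which only the
  exponents divisible by \<open>q - 1\<close> survive.\<close>

lemma of_int_fermat_defect: "of_int (fermat_defect TYPE('a)) = (- of_nat (2 * n choose n) :: 'a)"
proof -
  have sign: "(- 1 :: 'a) ^ n = 1"
    using cubes_uminus[of "1::'a"] by (simp add: cubes_eq)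
  have power_sum: "(\<Sum>x\<in>UNIV. (1 - x ^ 3) ^ N) =
      - (\<Sum>j | 0 < j \<and> j \<le> N \<and> n dvd j. of_nat (N choose j) * (- 1) ^ j :: 'a)"
    for N
    using sum_one_minus_power_power[where ?'a = 'a, of 3 N] card_field by simp
  have "{j. 0 < j \<and> j \<le> n \<and> n dvd j} = {n}"
    using n_pos by (auto dest: dvd_imp_le)
  then have sum_n: "(\<Sum>x\<in>UNIV. (1 - x ^ 3) ^ n) = (- 1 :: 'a)"
    using power_sum[of n] sign by simp
  have "j = n \<or> j = 2 * n" if "0 < j" "j \<le> 2 * n" "n dvd j" for j
  proof -
    obtain k where k: "j = n * k"
      using \<open>n dvd j\<close> by (elim dvdE)
    then have "k = 1 \<or> k = 2"
      using that n_pos by auto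
    then show ?thesis
      using k by auto
  qed
  then have "{j. 0 < j \<and> j \<le> 2 * n \<and> n dvd j} = {n, 2 * n}"
    using n_pos by auto
  then have sum_2n: "(\<Sum>x\<in>UNIV. (1 - x ^ 3) ^ (2 * n)) = (- of_nat (2 * n choose n) - 1 :: 'a)"
    using power_sum[of "2 * n"] sign n_pos by (simp add: power_mult)
  have "(of_nat (two_cubes_count (1::'a)) :: 'a) =
      (\<Sum>x\<in>UNIV. 1 + (1 - x ^ 3) ^ n + (1 - x ^ 3) ^ (2 * n))"
    unfolding two_cubes_count_eq_sum of_nat_sum of_nat_card_cube_roots ..
  also have "\<dots> = of_nat CARD('a) - 1 - of_nat (2 * n choose n) - 1"
    by (simp only: sum.distrib sum_n sum_2n) simp
  finally show ?thesis
    by (simp add: fermat_defect_def of_nat_CARD_finite_field)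
qed

end

section \<open>Cubic exponential sums\<close>

lemma power_sums_if_sum_eq_0:
  fixes x y z :: "'a::comm_ring_1"
  assumes "x + y + z = 0"
  shows "x\<^sup>2 + y\<^sup>2 + z\<^sup>2 = - 2 * (x * y + y * z + z * x)" "x ^ 3 + y ^ 3 + z ^ 3 = 3 * (x * y * z)"
proof -
  have z: "z = - x - y"
    using assms by (simp add: eq_neg_iff_add_eq_0 algebra_simps)
  show "x\<^sup>2 + y\<^sup>2 + z\<^sup>2 = - 2 * (x * y + y * z + z * x)" "x ^ 3 + y ^ 3 + z ^ 3 = 3 * (x * y * z)"
    unfolding z by (simp_all add: power2_eq_square power3_eq_cube algebra_simps)
qed

lemma square_le_if_sum_eq_0:
  fixes x y z :: real
  assumes "x + y + z = 0"
  shows "3 * x\<^sup>2 \<le> - 4 * (x * y + y * z + z * x)"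
proof -
  have z: "z = - x - y"
    using assms by simp
  have "- 4 * (x * y + y * z + z * x) - 3 * x\<^sup>2 = (x + 2 * y)\<^sup>2"
    unfolding z by (simp add: power2_eq_square algebra_simps)
  then show ?thesis
    by (metis diff_ge_0_iff_ge zero_le_power2)
qed

definition cubic_spectrum :: "nat \<Rightarrow> real multiset \<Rightarrow> real multiset" where
  "cubic_spectrum n X = {#real n#} + (\<Sum>\<theta>\<in>#X. replicate_mset n ((\<theta> - 1) / 3))"

locale cubic_character = cubic_field "TYPE('a)" n + additive_character \<psi>
  for n :: nat and \<psi> :: "'a::{field,finite} \<Rightarrow> complex"
begin

abbreviation cubic_graph :: "'a \<Rightarrow> 'a \<Rightarrow> bool" where
  "cubic_graph \<equiv> cayley3"

definition theta :: "'a \<Rightarrow> real" (\<open>\<theta>\<close>) where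
  "\<theta> b = Re (exp_sum UNIV (\<lambda>x. x ^ 3) b)"

abbreviation thetas :: "real multiset" (\<open>\<Theta>\<close>) where
  "\<Theta> \<equiv> {#\<theta> 1, \<theta> \<gamma>, \<theta> (\<gamma>\<^sup>2)#}"

lemma exp_sum_cubing: "exp_sum UNIV (\<lambda>x. x ^ 3) b = 1 + 3 * char_sum cubes b"
  using sum_over_cubes[of "\<lambda>y. \<psi> (b * y)"] by (simp add: exp_sum_def)

lemma theta_eq_exp_sum: "of_real (\<theta> b) = exp_sum UNIV (\<lambda>x. x ^ 3) b"
proof -
  have "cnj (exp_sum UNIV (\<lambda>x. x ^ 3) b) = exp_sum UNIV (\<lambda>x. x ^ 3) b"
    by (simp add: exp_sum_cubing cnj_char_sum cubes_uminus)
  then show ?thesis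
    unfolding theta_def by (simp add: Reals_cnj_iff)
qed

lemma char_sum_cubes: "char_sum cubes b = of_real ((\<theta> b - 1) / 3)"
  using theta_eq_exp_sum[of b] by (simp add: exp_sum_cubing)

lemma theta_0: "\<theta> 0 = real CARD('a)"
  by (simp add: theta_def)

lemma theta_mult_cube:
  assumes "r \<in> cubes"
  shows "\<theta> (b * r) = \<theta> b"
proof -
  obtain s where s: "s \<noteq> 0" "r = s ^ 3"
    using assms by (auto simp: cubes_def)
  have "exp_sum UNIV (\<lambda>x. x ^ 3) (b * r) = exp_sum UNIV (\<lambda>x. x ^ 3) b"
    unfolding exp_sum_def
    by (rule sum.reindex_bij_witness[of _ "\<lambda>x. x / s" "\<lambda>x. s * x"])
      (use s in \<open>auto simp: power_mult_distrib mult.assoc\<close>)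
  then show ?thesis
    by (simp add: theta_def)
qed

lemma sum_theta: "(\<Sum>b\<in>UNIV. \<theta> b) = real CARD('a)"
proof -
  have "complex_of_real (\<Sum>b\<in>UNIV. \<theta> b) = of_nat (CARD('a) * card {x \<in> UNIV. x ^ 3 = (0::'a)})"
    unfolding of_real_sum theta_eq_exp_sum by (rule sum_exp_sum) simp
  also have "{x \<in> UNIV. x ^ 3 = (0::'a)} = {0}"
    by auto
  finally have "complex_of_real (\<Sum>b\<in>UNIV. \<theta> b) = of_real (real CARD('a))"
    by simp
  then show ?thesis
    by (simp only: of_real_eq_iff)
qed

lemma sum_theta_sq: "(\<Sum>b\<in>UNIV. (\<theta> b)\<^sup>2) = real (CARD('a) * two_cubes_count (0::'a))"
proof -
  have "complex_of_real ((\<theta> b)\<^sup>2) = exp_sum (UNIV \<times> UNIV) (\<lambda>(x, y). x ^ 3 + y ^ 3) b" for b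
    by (simp only: power2_eq_square of_real_mult theta_eq_exp_sum exp_sum_mult)
  then have "complex_of_real (\<Sum>b\<in>UNIV. (\<theta> b)\<^sup>2) =
      (\<Sum>b\<in>UNIV. exp_sum (UNIV \<times> UNIV) (\<lambda>(x, y). x ^ 3 + y ^ 3) b)"
    by (simp only: of_real_sum)
  also have "\<dots> =
      of_nat (CARD('a) * card {p \<in> UNIV \<times> UNIV. (case p of (x, y) \<Rightarrow> x ^ 3 + y ^ 3) = (0::'a)})"
    by (rule sum_exp_sum) simp
  also have "{p \<in> UNIV \<times> UNIV. (case p of (x, y) \<Rightarrow> x ^ 3 + y ^ 3) = (0::'a)} =
      {(x, y). x ^ 3 + y ^ 3 = 0}"
    by auto
  finally have "complex_of_real (\<Sum>b\<in>UNIV. (\<theta> b)\<^sup>2) =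
      of_real (real (CARD('a) * two_cubes_count (0::'a)))"
    by (simp only: two_cubes_count_def of_real_of_nat_eq)
  then show ?thesis
    by (simp only: of_real_eq_iff)
qed

lemma sum_theta_cube:
  "(\<Sum>b\<in>UNIV. \<theta> b ^ 3) =
    real (CARD('a) * (two_cubes_count (0::'a) + (CARD('a) - 1) * two_cubes_count (1::'a)))"
proof -
  let ?f = "\<lambda>(z, p). z ^ 3 + (case p of (x, y) \<Rightarrow> x ^ 3 + y ^ 3) :: 'a"
  have "complex_of_real (\<theta> b ^ 3) = exp_sum (UNIV \<times> (UNIV \<times> UNIV)) ?f b" for b
    by (simp only: power3_eq_cube[of "\<theta> b"] of_real_mult theta_eq_exp_sum mult.assoc exp_sum_mult)
  then have "complex_of_real (\<Sum>b\<in>UNIV. \<theta> b ^ 3) = (\<Sum>b\<in>UNIV. exp_sum (UNIV \<times> (UNIV \<times> UNIV)) ?f b)"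
    by (simp only: of_real_sum)
  also have "\<dots> = of_nat (CARD('a) * card {p \<in> UNIV \<times> (UNIV \<times> UNIV). ?f p = 0})"
    by (rule sum_exp_sum) simp
  also have "{p \<in> UNIV \<times> (UNIV \<times> UNIV). ?f p = 0} =
      (SIGMA z:UNIV. {(x, y). x ^ 3 + y ^ 3 = - (z ^ 3)})"
    by (auto simp: eq_neg_iff_add_eq_0 add.commute)
  also have "card \<dots> = (\<Sum>z\<in>UNIV. two_cubes_count (- (z ^ 3) :: 'a))"
    by (simp add: two_cubes_count_def card_SigmaI)
  also have "\<dots> = two_cubes_count (0::'a) + (\<Sum>z\<in>UNIV - {0::'a}. two_cubes_count (1::'a))"
    by (subst sum.remove[of UNIV 0]) (auto simp: two_cubes_count_minus_cube)
  also have "\<dots> = two_cubes_count (0::'a) + (CARD('a) - 1) * two_cubes_count (1::'a)"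
    by simp
  finally show ?thesis
    by (metis of_real_eq_iff of_real_of_nat_eq)
qed

lemma theta_sum: "\<theta> 1 + \<theta> \<gamma> + \<theta> (\<gamma>\<^sup>2) = 0"
  and theta_pairwise_products: "\<theta> 1 * \<theta> \<gamma> + \<theta> \<gamma> * \<theta> (\<gamma>\<^sup>2) + \<theta> (\<gamma>\<^sup>2) * \<theta> 1 = - 3 * real CARD('a)"
  and theta_product: "\<theta> 1 * \<theta> \<gamma> * \<theta> (\<gamma>\<^sup>2) = real CARD('a) * of_int (fermat_defect TYPE('a))"
proof -
  have power_sum: "(\<Sum>b\<in>UNIV. \<theta> b ^ k) =
      real CARD('a) ^ k + real n * (\<theta> 1 ^ k + \<theta> \<gamma> ^ k + \<theta> (\<gamma>\<^sup>2) ^ k)" for k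
    using sum_coset_invariant[of "\<lambda>b. \<theta> b ^ k"] theta_mult_cube theta_0 by simp
  have n: "real n \<noteq> 0"
    using n_pos by simp
  show sum_eq: "\<theta> 1 + \<theta> \<gamma> + \<theta> (\<gamma>\<^sup>2) = 0"
    using power_sum[of 1] sum_theta n by simp
  have "real n * ((\<theta> 1)\<^sup>2 + (\<theta> \<gamma>)\<^sup>2 + (\<theta> (\<gamma>\<^sup>2))\<^sup>2) = real n * (6 * real CARD('a))"
    using power_sum[of 2] sum_theta_sq unfolding two_cubes_count_0 card_field
    by (simp add: power2_eq_square algebra_simps)
  then show "\<theta> 1 * \<theta> \<gamma> + \<theta> \<gamma> * \<theta> (\<gamma>\<^sup>2) + \<theta> (\<gamma>\<^sup>2) * \<theta> 1 = - 3 * real CARD('a)"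
    using n power_sums_if_sum_eq_0(1)[OF sum_eq] by simp
  have "real n * (\<theta> 1 ^ 3 + \<theta> \<gamma> ^ 3 + \<theta> (\<gamma>\<^sup>2) ^ 3) =
      real n * (3 * (real CARD('a) * of_int (fermat_defect TYPE('a))))"
    using power_sum[of 3] sum_theta_cube unfolding two_cubes_count_0 card_field fermat_defect_def
    by (simp add: power3_eq_cube algebra_simps)
  then show "\<theta> 1 * \<theta> \<gamma> * \<theta> (\<gamma>\<^sup>2) = real CARD('a) * of_int (fermat_defect TYPE('a))"
    using n power_sums_if_sum_eq_0(2)[OF sum_eq] by simp
qed

lemma theta_values: "b \<noteq> 0 \<Longrightarrow> \<theta> b \<in># \<Theta>"
  using coset_invariant_values[of \<theta> b] theta_mult_cube by auto

lemma is_spectrum_cubic_graph: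
  "is_spectrum (adj_matrix cubic_graph) (cubic_spectrum n \<Theta>)"
proof -
  let ?f = "\<lambda>b. (\<theta> b - 1) / 3"
  have UNIV: "mset_set (UNIV::'a set) = add_mset 0 (mset_set (UNIV - {0}))"
    by (metis UNIV_I finite mset_set.remove)
  have "is_spectrum (adj_matrix (cayley_graph (cubes :: 'a set)))
      (image_mset (\<lambda>b. Re (char_sum cubes b)) (mset_set UNIV))"
    by (rule is_spectrum_cayley_graph) (rule cubes_uminus)
  also have "image_mset (\<lambda>b. Re (char_sum cubes b)) (mset_set UNIV) =
      add_mset (?f 0) (image_mset ?f (mset_set (UNIV - {0})))"
    by (simp only: UNIV image_mset_add_mset char_sum_cubes Re_complex_of_real)
  also have "image_mset ?f (mset_set (UNIV - {0})) =
      replicate_mset n (?f 1) + replicate_mset n (?f \<gamma>) + replicate_mset n (?f (\<gamma>\<^sup>2))"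
    by (rule image_mset_coset_invariant) (simp add: theta_mult_cube)
  also have "?f 0 = real n"
    by (simp add: theta_0 card_field)
  finally show ?thesis
    by (simp add: cayley3_eq_cayley_graph cubic_spectrum_def add_ac)
qed

lemma theta_sq_le:
  assumes "b \<noteq> 0"
  shows "(\<theta> b)\<^sup>2 \<le> 4 * real CARD('a)"
proof -
  consider "\<theta> b = \<theta> 1" | "\<theta> b = \<theta> \<gamma>" | "\<theta> b = \<theta> (\<gamma>\<^sup>2)"
    using theta_values[OF assms] by auto
  then show ?thesis
  proof cases
    case 1
    then show ?thesis
      using square_le_if_sum_eq_0[of "\<theta> 1" "\<theta> \<gamma>" "\<theta> (\<gamma>\<^sup>2)"] theta_sum theta_pairwise_products by simp
  next
    case 2
    then show ?thesis
      using square_le_if_sum_eq_0[of "\<theta> \<gamma>" "\<theta> (\<gamma>\<^sup>2)" "\<theta> 1"] theta_sum theta_pairwise_products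
      by (simp add: add_ac)
  next
    case 3
    then show ?thesis
      using square_le_if_sum_eq_0[of "\<theta> (\<gamma>\<^sup>2)" "\<theta> 1" "\<theta> \<gamma>"] theta_sum theta_pairwise_products
      by (simp add: add_ac)
  qed
qed

lemma graph_connected_cubic_graph:
  assumes "n > 1"
  shows "graph_connected cubic_graph"
  unfolding cayley3_eq_cayley_graph
proof (rule graph_connected_cayley_graph)
  let ?q = "real CARD('a)"
  have "?q > 4"
    using assms card_field by simp
  then have "4 * ?q < ?q\<^sup>2"
    by (simp add: power2_eq_square)
  fix b :: 'a
  assume "b \<noteq> 0"
  then have "\<theta> b \<noteq> ?q"
    using theta_sq_le[of b] \<open>4 * ?q < ?q\<^sup>2\<close> by auto
  then have "(\<theta> b - 1) / 3 \<noteq> real n"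
    by (simp add: card_field field_simps)
  then show "char_sum cubes b \<noteq> of_nat (card (cubes :: 'a set))"
    unfolding char_sum_cubes card_cubes by (metis of_real_eq_iff of_real_of_nat_eq)
qed

lemma strongly_regular_cubic_graph:
  assumes "\<And>b. b \<noteq> 0 \<Longrightarrow> \<theta> b = r \<or> \<theta> b = s"
  shows "strongly_regular cubic_graph"
  unfolding cayley3_eq_cayley_graph
proof (rule strongly_regular_cayley_graph)
  fix b :: 'a
  assume "b \<noteq> 0"
  then show "char_sum cubes b = of_real ((r - 1) / 3) \<or> char_sum cubes b = of_real ((s - 1) / 3)"
    using assms[of b] unfolding char_sum_cubes by auto
qed (simp_all add: cubes_uminus zero_notin_cubes)

end

section \<open>The spectrum of the cubic Cayley graph\<close>

lemma power_eq_Suc_geometric_sum: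
  fixes p m :: nat
  assumes "p > 0"
  shows "p ^ m = (p - 1) * (\<Sum>i<m. p ^ i) + 1"
proof (induction m)
  case (Suc m)
  have "p ^ Suc m = (p - 1) * p ^ m + p ^ m"
    using assms by (cases p) auto
  also have "\<dots> = (p - 1) * p ^ m + ((p - 1) * (\<Sum>i<m. p ^ i) + 1)"
    using Suc by simp
  also have "\<dots> = (p - 1) * (\<Sum>i<Suc m. p ^ i) + 1"
    by (simp add: distrib_left)
  finally show ?case .
qed simp

lemma third_of_geometric_sum:
  fixes p m :: nat
  assumes "p > 1" "3 dvd (p ^ m - 1) div (p - 1)"
  shows "p ^ m = 3 * ((p ^ m - 1) div 3) + 1" "p - 1 dvd (p ^ m - 1) div 3"
proof -
  let ?s = "\<Sum>i<m. p ^ i"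
  have geometric: "p ^ m = (p - 1) * ?s + 1"
    using assms(1) by (intro power_eq_Suc_geometric_sum) simp
  then have "(p ^ m - 1) div (p - 1) = ?s"
    using assms(1) by simp
  then obtain j where "?s = 3 * j"
    using assms(2) by auto
  then have "p ^ m = 3 * ((p - 1) * j) + 1"
    using geometric by simp
  then show "p ^ m = 3 * ((p ^ m - 1) div 3) + 1" "p - 1 dvd (p ^ m - 1) div 3"
    by simp_all
qed

locale integral_cubic_character = cubic_character n \<psi>
  for n :: nat and \<psi> :: "'a::{field,finite} \<Rightarrow> complex" +
  fixes p m :: nat
  assumes prime_p: "prime p" and card_prime_power: "CARD('a) = p ^ m"
    and prime_field_dvd: "p - 1 dvd n" and n_gt_1: "n > 1"
begin

lemma char_p: "CHAR('a) = p"
  using prime_p card_prime_power by (rule CHAR_eq_if_CARD_prime_power)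

lemma power_m: "p ^ m = 3 * n + 1"
  using card_field card_prime_power by simp

lemma prime_field_cubes:
  assumes "0 < k" "k < p"
  shows "(of_nat k :: 'a) \<in> cubes"
proof -
  have nonzero: "of_nat k \<noteq> (0::'a)"
    using assms nat_dvd_not_less by (simp add: of_nat_eq_0_iff_char_dvd char_p)
  have "of_nat k * of_nat k ^ (p - 1) = (of_nat k :: 'a)"
    using of_nat_power_CHAR[where ?'a = 'a, of k] prime_p prime_gt_0_nat[of p]
    by (simp add: char_p power_eq_if)
  then have "of_nat k ^ (p - 1) = (1::'a)"
    using nonzero by simp
  then have "of_nat k ^ n = (1::'a)"
    using prime_field_dvd by (auto simp: power_mult)
  then show ?thesis
    by (simp add: cubes_eq)
qed

lemma theta_integral: "\<exists>j. \<theta> b = of_int (3 * j + 1)"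
proof -
  have "char_sum cubes b \<in> \<int>"
    by (rule char_sum_in_Ints) (simp add: char_p cubes_mult prime_field_cubes)
  then obtain j where "complex_of_real ((\<theta> b - 1) / 3) = of_int j"
    unfolding char_sum_cubes by (elim Ints_cases)
  then have "(\<theta> b - 1) / 3 = of_int j"
    by (metis of_real_eq_iff of_real_of_int_eq)
  then show ?thesis
    by (intro exI[of _ j]) simp
qed

lemma integral_triple:
  obtains x y z :: int where "\<theta> 1 = of_int x" "\<theta> \<gamma> = of_int y" "\<theta> (\<gamma>\<^sup>2) = of_int z"
    "x mod 3 = 1" "y mod 3 = 1" "z mod 3 = 1"
    "x + y + z = 0" "x * y + y * z + z * x = - 3 * int p ^ m"
    "x * y * z = int p ^ m * fermat_defect TYPE('a)"
proof -
  have "\<exists>k. \<theta> b = of_int k \<and> k mod 3 = 1" for b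
  proof -
    obtain j where "\<theta> b = of_int (3 * j + 1)"
      using theta_integral by blast
    then show ?thesis
      by (intro exI[of _ "3 * j + 1"]) simp
  qed
  then obtain x y z where theta: "\<theta> 1 = of_int x" "\<theta> \<gamma> = of_int y" "\<theta> (\<gamma>\<^sup>2) = of_int z"
    and mod3: "x mod 3 = 1" "y mod 3 = 1" "z mod 3 = 1"
    by meson
  have "real_of_int (x + y + z) = of_int 0"
    "real_of_int (x * y + y * z + z * x) = of_int (- 3 * int p ^ m)"
    "real_of_int (x * y * z) = of_int (int p ^ m * fermat_defect TYPE('a))"
    using theta_sum theta_pairwise_products theta_product unfolding theta card_prime_power
    by simp_all
  then show thesis
    unfolding of_int_eq_iff using that theta mod3 by blast
qed

lemma ex_integral_spectrum:
  "\<exists>M. is_spectrum (adj_matrix cubic_graph) M \<and> (\<forall>x\<in>#M. x \<in> \<int>)"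
proof -
  have "(\<theta> b - 1) / 3 \<in> \<int>" for b
    using theta_integral[of b] by auto
  then have "\<forall>x\<in>#cubic_spectrum n \<Theta>. x \<in> \<int>"
    by (auto simp: cubic_spectrum_def split: if_splits)
  then show ?thesis
    using is_spectrum_cubic_graph by blast
qed

lemma not_dvd_fermat_defect:
  assumes "p mod 3 = 1"
  shows "\<not> int p dvd fermat_defect TYPE('a)"
proof
  assume "int p dvd fermat_defect TYPE('a)"
  then have "(of_int (fermat_defect TYPE('a)) :: 'a) = 0"
    by (simp add: of_int_eq_0_iff_char_dvd char_p)
  then have "p dvd (2 * n choose n)"
    unfolding of_int_fermat_defect by (simp add: of_nat_eq_0_iff_char_dvd char_p)
  moreover have "n = (p ^ m - 1) div 3"
    using power_m by simp
  ultimately show False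
    using not_prime_dvd_central_binomial[OF prime_p assms, of m] by simp
qed

lemma split_exponent:
  assumes "p mod 3 = 1"
  shows "\<exists>t>0. m = 3 * t"
proof -
  let ?s = "\<Sum>i<m. p ^ i"
  obtain j where "n = (p - 1) * j"
    using prime_field_dvd by (elim dvdE)
  then have "?s = 3 * j"
    using power_m power_eq_Suc_geometric_sum[of p m] prime_gt_1_nat[OF prime_p] by simp
  then have "3 dvd ?s"
    by simp
  moreover have "[?s = (\<Sum>i<m. 1 ^ i)] (mod 3)"
    using assms by (intro cong_sum cong_pow) (simp add: cong_def)
  ultimately obtain t where "m = 3 * t"
    by (auto simp: cong_dvd_iff)
  moreover from this have "t > 0"
    using power_m n_gt_1 by (cases t) auto
  ultimately show ?thesis
    by blast
qed

lemma split_integral_triple: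
  assumes "p mod 3 = 1" "m = 3 * t" "t > 0"
  obtains u v w where "\<Theta> = image_mset ((*) (real p ^ t)) (image_mset real_of_int {#u, v, w#})"
    "u mod 3 = 1" "v mod 3 = 1" "u + v + w = 0" "u * v + v * w + w * u = - 3 * int p ^ t"
    "u * v * w = fermat_defect TYPE('a)"
proof -
  obtain x y z where theta: "\<theta> 1 = of_int x" "\<theta> \<gamma> = of_int y" "\<theta> (\<gamma>\<^sup>2) = of_int z"
    and mod3: "x mod 3 = 1" "y mod 3 = 1" and relations: "x + y + z = 0"
      "x * y + y * z + z * x = - 3 * int p ^ m" "x * y * z = int p ^ m * fermat_defect TYPE('a)"
    using integral_triple by metis
  have "prime (int p)" "int p dvd - 3 * int p ^ t"
    using prime_p assms(3) by simp_all
  moreover have "x * y + y * z + z * x = - 3 * int p ^ t * int p ^ (2 * t)"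
    "x * y * z = fermat_defect TYPE('a) * int p ^ (3 * t)"
    using relations(2,3) by (simp_all add: assms(2) flip: power_add)
  ultimately obtain u v w where xyz: "x = int p ^ t * u" "y = int p ^ t * v" "z = int p ^ t * w"
    and reduced: "u + v + w = 0" "u * v + v * w + w * u = - 3 * int p ^ t"
      "u * v * w = fermat_defect TYPE('a)"
    using triple_descent[OF _ _ relations(1)] by metis
  have "[int p = 1] (mod 3)"
    using assms(1) zmod_int[of p 3] by (simp add: cong_def)
  then have "[int p ^ t = 1 ^ t] (mod 3)"
    by (rule cong_pow)
  then have "[int p ^ t * k = 1 * k] (mod 3)" for k
    by (intro cong_mult) auto
  then have "u mod 3 = 1" "v mod 3 = 1"
    using mod3 unfolding xyz cong_def by simp_all
  moreover have "\<Theta> = image_mset ((*) (real p ^ t)) (image_mset real_of_int {#u, v, w#})"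
    by (simp add: theta xyz)
  ultimately show thesis
    using that reduced by metis
qed

lemma split_normalized_rep:
  assumes p: "p mod 3 = 1" and m: "m = 3 * t" "t > 0"
  obtains a b where "normalized_rep (int p) (int p ^ t) a b"
    "\<Theta> = image_mset ((*) (real p ^ t)) (split_values a b)"
proof -
  obtain u v w where theta: "\<Theta> = image_mset ((*) (real p ^ t)) (image_mset real_of_int {#u, v, w#})"
    and mod3: "u mod 3 = 1" "v mod 3 = 1"
    and relations: "u + v + w = 0" "u * v + v * w + w * u = - 3 * int p ^ t"
      "u * v * w = fermat_defect TYPE('a)"
    using split_integral_triple[OF p m] by metis
  obtain a b where a: "a \<in> {u, v, w}" and ab: "4 * int p ^ t = a\<^sup>2 + 27 * b\<^sup>2"
    and uvw: "image_mset real_of_int {#u, v, w#} = split_values a b"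
    using split_triple[OF relations(1,2) mod3] by metis
  have "w mod 3 = 1"
    using relations(1) mod3 by presburger
  then have "a mod 3 = 1"
    using a mod3 by blast
  moreover have "\<not> int p dvd a"
    using a not_dvd_fermat_defect[OF p] unfolding relations(3)[symmetric] by auto
  then have "coprime a (int p)"
    using prime_p prime_imp_coprime[of "int p"] coprime_commute by auto
  ultimately have "normalized_rep (int p) (int p ^ t) a b"
    using ab by (simp add: normalized_rep_def)
  then show thesis
    using that theta unfolding uvw by blast
qed

definition cubic_rep :: "int \<Rightarrow> int \<Rightarrow> bool" where
  "cubic_rep a b \<longleftrightarrow>
    4 * root 3 (real (p ^ m)) = of_int (a\<^sup>2 + 27 * b\<^sup>2) \<and> a mod 3 = 1 \<and> coprime a (int p)"

lemma root_3_power_m: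
  assumes "m = 3 * t"
  shows "root 3 (real (p ^ m)) = real p ^ t"
proof -
  have cube: "real (p ^ m) = (real p ^ t) ^ 3"
    by (simp add: assms mult.commute flip: power_mult)
  show ?thesis
    unfolding cube by (simp add: real_root_power_cancel)
qed

lemma cubic_rep_iff_normalized_rep:
  assumes "m = 3 * t"
  shows "cubic_rep a b \<longleftrightarrow> normalized_rep (int p) (int p ^ t) a b"
proof -
  have "4 * root 3 (real (p ^ m)) = of_int (4 * int p ^ t)"
    unfolding root_3_power_m[OF assms] by simp
  then show ?thesis
    unfolding cubic_rep_def normalized_rep_def by (simp only: of_int_eq_iff)
qed

lemma ex_cubic_rep:
  assumes "p mod 3 = 1"
  shows "\<exists>a b. cubic_rep a b"
proof -
  obtain t where m: "m = 3 * t" "t > 0"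
    using split_exponent[OF assms] by blast
  show ?thesis
    unfolding cubic_rep_iff_normalized_rep[OF m(1)] using split_normalized_rep[OF assms m] by blast
qed

lemma cubic_rep_unique:
  assumes "p mod 3 = 1" "cubic_rep a b" "cubic_rep a' b'"
  shows "a = a' \<and> \<bar>b\<bar> = \<bar>b'\<bar>"
proof -
  obtain t where m: "m = 3 * t" "t > 0"
    using split_exponent[OF assms(1)] by blast
  have "p \<noteq> 2"
    using assms(1) by auto
  then have "prime (int p)" "odd (int p)"
    using prime_p prime_odd_nat[of p] prime_ge_2_nat[of p] by simp_all
  then show ?thesis
    using m(2) assms(2,3) unfolding cubic_rep_iff_normalized_rep[OF m(1)]
    by (rule normalized_rep_unique)
qed

lemma split_spectrum:
  assumes "p mod 3 = 1" "cubic_rep a b"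
  shows "is_spectrum (adj_matrix cubic_graph)
    ({#real n#} + replicate_mset n ((of_int a * root 3 (real (p ^ m)) - 1) / 3)
      + replicate_mset n ((- (1/2) * of_int (a + 9 * b) * root 3 (real (p ^ m)) - 1) / 3)
      + replicate_mset n ((- (1/2) * of_int (a - 9 * b) * root 3 (real (p ^ m)) - 1) / 3))"
proof -
  obtain t where m: "m = 3 * t" "t > 0"
    using split_exponent[OF assms(1)] by blast
  obtain a' b' where rep: "normalized_rep (int p) (int p ^ t) a' b'"
    and theta: "\<Theta> = image_mset ((*) (real p ^ t)) (split_values a' b')"
    using split_normalized_rep[OF assms(1) m] by metis
  have "cubic_rep a' b'"
    using rep by (simp only: cubic_rep_iff_normalized_rep[OF m(1)])
  then have "a = a'" "b = b' \<or> b = - b'"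
    using cubic_rep_unique[OF assms] by (auto simp: abs_eq_iff)
  then show ?thesis
    using is_spectrum_cubic_graph unfolding theta root_3_power_m[OF m(1)] cubic_spectrum_def
    by (auto simp: ac_simps)
qed

lemma inert_triple_thetas:
  assumes "p mod 3 = 2" "m = 2 * t"
  shows "\<Theta> = image_mset ((*) ((- real p) ^ t)) {#1, 1, - 2#}"
proof -
  obtain x y z where theta: "\<theta> 1 = of_int x" "\<theta> \<gamma> = of_int y" "\<theta> (\<gamma>\<^sup>2) = of_int z"
    and mod3: "x mod 3 = 1" "y mod 3 = 1"
    and relations: "x + y + z = 0" "x * y + y * z + z * x = - 3 * int p ^ m"
    using integral_triple by metis
  have "\<Theta> = image_mset real_of_int {#x, y, z#}"
    by (simp add: theta)
  also have "{#x, y, z#} = image_mset ((*) ((- int p) ^ t)) {#1, 1, - 2#}"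
    using inert_triple[OF prime_p assms(1) relations(1) _ mod3] relations(2) assms(2) by simp
  finally show ?thesis
    by simp
qed

lemma inert_exponent:
  assumes "p mod 3 = 2"
  shows "\<exists>t. m = 2 * t"
proof -
  have "even m"
  proof (rule ccontr)
    assume "odd m"
    then obtain k where k: "m = 2 * k + 1"
      by (elim oddE)
    have "[p ^ m = 2 ^ m] (mod 3)"
      using assms by (intro cong_pow) (simp add: cong_def)
    also have "(2::nat) ^ m = 4 ^ k * 2"
      by (simp add: k power_mult)
    also have "[4 ^ k * 2 = 1 ^ k * 2] (mod 3::nat)"
      by (intro cong_mult cong_pow) (simp_all add: cong_def)
    finally show False
      using power_m by (simp add: cong_def)
  qed
  then show ?thesis
    by (elim evenE) blast
qed

lemma inert_spectrum:
  assumes "p mod 3 = 2" "m = 2 * t"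
  shows "is_spectrum (adj_matrix cubic_graph)
    ({#real n#} + replicate_mset (2 * n) (((- real p) ^ t - 1) / 3)
      + replicate_mset n ((- 2 * (- real p) ^ t - 1) / 3))"
proof -
  have "replicate_mset (2 * n) x = replicate_mset n x + replicate_mset n x" for x :: real
    by (simp add: mult_2 multiset_eq_iff)
  then show ?thesis
    using is_spectrum_cubic_graph unfolding inert_triple_thetas[OF assms]
    by (simp add: cubic_spectrum_def ac_simps)
qed

lemma sqrt_power_m:
  assumes "m = 2 * t"
  shows "sqrt (real (p ^ m)) = real p ^ t"
proof -
  have square: "real (p ^ m) = (real p ^ t)\<^sup>2"
    by (simp add: assms mult.commute flip: power_mult)
  show ?thesis
    unfolding square by simp
qed

lemma inert_spectrum_0_mod_4:
  assumes "p mod 3 = 2" "m mod 4 = 0"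
  shows "is_spectrum (adj_matrix cubic_graph)
    ({#real n#} + replicate_mset (2 * n) ((sqrt (real (p ^ m)) - 1) / 3)
      + replicate_mset n ((- 2 * sqrt (real (p ^ m)) - 1) / 3))"
proof -
  have t: "m = 2 * (m div 2)" "even (m div 2)"
    using assms(2) by presburger+
  then have "(- real p) ^ (m div 2) = sqrt (real (p ^ m))"
    unfolding sqrt_power_m[OF t(1)] by simp
  from inert_spectrum[OF assms(1) t(1), unfolded this] show ?thesis .
qed

lemma inert_spectrum_2_mod_4:
  assumes "p mod 3 = 2" "m mod 4 = 2"
  shows "is_spectrum (adj_matrix cubic_graph)
    ({#real n#} + replicate_mset n ((2 * sqrt (real (p ^ m)) - 1) / 3)
      + replicate_mset (2 * n) ((- sqrt (real (p ^ m)) - 1) / 3))"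
proof -
  have t: "m = 2 * (m div 2)" "odd (m div 2)"
    using assms(2) by presburger+
  then have "(- real p) ^ (m div 2) = - sqrt (real (p ^ m))"
    unfolding sqrt_power_m[OF t(1)] by simp
  from inert_spectrum[OF assms(1) t(1), unfolded this] show ?thesis
    by (simp add: add.commute)
qed

lemma inert_strongly_regular:
  assumes "p mod 3 = 2"
  shows "strongly_regular cubic_graph"
proof -
  obtain t where "m = 2 * t"
    using inert_exponent[OF assms] by blast
  show ?thesis
  proof (rule strongly_regular_cubic_graph)
    show "\<theta> b = (- real p) ^ t \<or> \<theta> b = - 2 * (- real p) ^ t" if "b \<noteq> 0" for b
      using theta_values[OF that] unfolding inert_triple_thetas[OF assms \<open>m = 2 * t\<close>] by auto
  qed
qed

end

theorem theorem6p1: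
  fixes p m :: nat
  assumes "prime p"
    and "CARD('a::{field,finite}) = p ^ m"
    and "3 dvd ((p ^ m - 1) div (p - 1))"
    and "p ^ m \<ge> 5"
  defines "q \<equiv> p ^ m" and "n \<equiv> (p ^ m - 1) div 3"
  shows "graph_connected (cayley3 :: 'a \<Rightarrow> 'a \<Rightarrow> bool)
    \<and> (\<exists>M. is_spectrum (adj_matrix (cayley3 :: 'a \<Rightarrow> 'a \<Rightarrow> bool)) M \<and> (\<forall>x\<in>#M. x \<in> \<int>))
    \<and> (p mod 3 = 1 \<longrightarrow>
         (\<exists>t. m = 3 * t) \<and>
         (\<exists>a b::int. 4 * root 3 (real q) = of_int (a^2 + 27 * b^2) \<and> a mod 3 = 1 \<and> coprime a (int p)) \<and>
         (\<forall>a b a' b'::int. 4 * root 3 (real q) = of_int (a^2 + 27 * b^2) \<and> a mod 3 = 1 \<and> coprime a (int p)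
             \<and> 4 * root 3 (real q) = of_int (a'^2 + 27 * b'^2) \<and> a' mod 3 = 1 \<and> coprime a' (int p)
             \<longrightarrow> a = a' \<and> \<bar>b\<bar> = \<bar>b'\<bar>) \<and>
         (\<forall>a b::int. 4 * root 3 (real q) = of_int (a^2 + 27 * b^2) \<and> a mod 3 = 1 \<and> coprime a (int p) \<longrightarrow>
            is_spectrum (adj_matrix (cayley3 :: 'a \<Rightarrow> 'a \<Rightarrow> bool))
              ({# real n #}
               + replicate_mset n ((a * root 3 (real q) - 1) / 3)
               + replicate_mset n ((- (1/2) * (a + 9 * b) * root 3 (real q) - 1) / 3)
               + replicate_mset n ((- (1/2) * (a - 9 * b) * root 3 (real q) - 1) / 3))))
    \<and> (p mod 3 = 2 \<longrightarrow>
         (\<exists>t. m = 2 * t) \<and>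
         (m mod 4 = 0 \<longrightarrow>
            is_spectrum (adj_matrix (cayley3 :: 'a \<Rightarrow> 'a \<Rightarrow> bool))
              ({# real n #}
               + replicate_mset (2 * n) ((sqrt (real q) - 1) / 3)
               + replicate_mset n ((- 2 * sqrt (real q) - 1) / 3))) \<and>
         (m mod 4 = 2 \<longrightarrow>
            is_spectrum (adj_matrix (cayley3 :: 'a \<Rightarrow> 'a \<Rightarrow> bool))
              ({# real n #}
               + replicate_mset n ((2 * sqrt (real q) - 1) / 3)
               + replicate_mset (2 * n) ((- sqrt (real q) - 1) / 3))) \<and>
         strongly_regular (cayley3 :: 'a \<Rightarrow> 'a \<Rightarrow> bool))"
proof -
  have p: "p > 1"
    using assms(1) prime_gt_1_nat by blast
  have n: "p ^ m = 3 * n + 1" "p - 1 dvd n"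
    unfolding n_def using third_of_geometric_sum[OF p assms(3)] by simp_all
  have "CARD('a) = CHAR('a) ^ m"
    using CHAR_eq_if_CARD_prime_power[OF assms(1,2)] assms(2) by simp
  then obtain \<psi> :: "'a \<Rightarrow> complex" where "additive_character \<psi>"
    using ex_additive_character by blast
  then interpret additive_character \<psi> .
  interpret integral_cubic_character n \<psi> p m
    using assms(1,2,4) n by unfold_locales auto
  show ?thesis
    unfolding q_def
    using graph_connected_cubic_graph[OF n_gt_1] ex_integral_spectrum
      split_exponent ex_cubic_rep cubic_rep_unique split_spectrum
      inert_exponent inert_spectrum_0_mod_4 inert_spectrum_2_mod_4 inert_strongly_regular
    unfolding cubic_rep_def
    by (intro conjI impI allI) blast+
qed

end
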